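(* Let $T$ be a tree with at least two vertices and with $n_1$ leaves. Then $F_t(T) \ge n_1$, with equality if and only if $T \in \mathcal{F}$.
   Context: All graphs are finite, simple and undirected. Forcing process: given a graph $G$ and an initial set $S \subseteq V(G)$ of colored vertices, at each step a colored vertex that has exactly one non-colored neighbor forces (colors) that neighbor. $S$ is a forcing set if iterating this eventually colors all of $V(G)$. A total forcing set (TF-set) is a forcing set $S$ such that $G[S]$ has no isolated vertex; $F_t(G)$ is the minimum cardinality of a TF-set of $G$. A leaf is a vertex of degree $1$; a strong support vertex is a vertex adjacent to at least two leaves. The family $\mathcal{F}$ is the smallest family of trees containing the path $P_2$ and closed under the following five operations, each producing a tree $T$ from a tree $T'$: (O1) if $uv$ is an edge of $T'$ with at least one of $u,v$ of degree at most $2$ in $T'$, subdivide $uv$ once; (O2) if $v$ is a strong support vertex of $T'$, add a new leaf adjacent to $v$; (O3) if $w$ is a strong support vertex of $T'$ and $v$ is a leaf neighbor of $w$, add two new leaves adjacent to $v$; (O4) if $v$ has degree at least $2$ in $T'$, add a new path $xyz$ and the edge $vy$; (O5) if $v$ has degree at least $2$ in $T'$, add new vertices $u_1,v_1,v_2,v_3,v_4,u_3$ with edges $u_1v_1, v_1v_2, v_2v_3, v_3v_4, v_3u_3$ (a star $K_{1,3}$ centered at $v_3$ with one edge subdivided twice) and the edge $vv_1$. *)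

theory Defs
  imports Main
begin

text \<open>
  A graph is given by its vertex set \<open>V\<close> and its set \<open>E\<close> of two-element edges.
\<close>

definition simple_graph :: "'a set \<Rightarrow> 'a set set \<Rightarrow> bool" where
  "simple_graph V E \<longleftrightarrow> finite V \<and> (\<forall>e\<in>E. e \<subseteq> V \<and> card e = 2)"

definition nbrs :: "'a set set \<Rightarrow> 'a \<Rightarrow> 'a set" where
  "nbrs E v = {u. {v, u} \<in> E}"

definition deg :: "'a set set \<Rightarrow> 'a \<Rightarrow> nat" where
  "deg E v = card (nbrs E v)"

definition leaves :: "'a set \<Rightarrow> 'a set set \<Rightarrow> 'a set" where
  "leaves V E = {v \<in> V. deg E v = 1}"

definition strong_support :: "'a set \<Rightarrow> 'a set set \<Rightarrow> 'a \<Rightarrow> bool" where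
  "strong_support V E v \<longleftrightarrow> v \<in> V \<and> card (nbrs E v \<inter> leaves V E) \<ge> 2"

definition connected_graph :: "'a set \<Rightarrow> 'a set set \<Rightarrow> bool" where
  "connected_graph V E \<longleftrightarrow>
     V \<noteq> {} \<and> (\<forall>u\<in>V. \<forall>v\<in>V. (\<lambda>x y. {x, y} \<in> E)\<^sup>*\<^sup>* u v)"

definition is_cycle :: "'a set set \<Rightarrow> 'a list \<Rightarrow> bool" where
  "is_cycle E c \<longleftrightarrow> length c \<ge> 3 \<and> distinct c \<and>
     (\<forall>i. Suc i < length c \<longrightarrow> {c ! i, c ! Suc i} \<in> E) \<and> {last c, hd c} \<in> E"

definition tree :: "'a set \<Rightarrow> 'a set set \<Rightarrow> bool" where
  "tree V E \<longleftrightarrow> simple_graph V E \<and> connected_graph V E \<and> (\<nexists>c. is_cycle E c)"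

inductive force_step :: "'a set set \<Rightarrow> 'a set \<Rightarrow> 'a set \<Rightarrow> bool" for E where
  "v \<in> S \<Longrightarrow> nbrs E v - S = {w} \<Longrightarrow> force_step E S (insert w S)"

definition forcing_set :: "'a set \<Rightarrow> 'a set set \<Rightarrow> 'a set \<Rightarrow> bool" where
  "forcing_set V E S \<longleftrightarrow> S \<subseteq> V \<and> (force_step E)\<^sup>*\<^sup>* S V"

definition induced_edges :: "'a set set \<Rightarrow> 'a set \<Rightarrow> 'a set set" where
  "induced_edges E S = {e \<in> E. e \<subseteq> S}"

definition total_forcing_set :: "'a set \<Rightarrow> 'a set set \<Rightarrow> 'a set \<Rightarrow> bool" where
  "total_forcing_set V E S \<longleftrightarrow>
     forcing_set V E S \<and> (\<forall>v\<in>S. deg (induced_edges E S) v \<noteq> 0)"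

text \<open>
  Only meaningful when a total forcing set exists; this is the case for every finite graph
  without isolated vertices, whose whole vertex set is one.
\<close>

definition total_forcing_number :: "'a set \<Rightarrow> 'a set set \<Rightarrow> nat" where
  "total_forcing_number V E = (LEAST k. \<exists>S. total_forcing_set V E S \<and> card S = k)"

text \<open>
  All operations only add vertices, so every tree occurring in the construction of a tree \<open>T\<close>
  lives on a subset of the vertices of \<open>T\<close>. Since the names of the new vertices are arbitrary,
  the family is closed under isomorphism within the type \<open>'a\<close>, and its restriction to \<open>'a\<close>
  loses no derivations even if \<open>'a\<close> is finite.
\<close>

inductive family_F :: "'a set \<Rightarrow> 'a set set \<Rightarrow> bool" where
  P2: "a \<noteq> b \<Longrightarrow> family_F {a, b} {{a, b}}"
| O1: "\<lbrakk>family_F V E; {u, v} \<in> E; deg E u \<le> 2 \<or> deg E v \<le> 2; w \<notin> V\<rbrakk>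
    \<Longrightarrow> family_F (insert w V) ((E - {{u, v}}) \<union> {{u, w}, {w, v}})"
| O2: "\<lbrakk>family_F V E; strong_support V E v; w \<notin> V\<rbrakk>
    \<Longrightarrow> family_F (insert w V) (insert {v, w} E)"
| O3: "\<lbrakk>family_F V E; strong_support V E w; v \<in> nbrs E w \<inter> leaves V E;
      distinct [x, y]; {x, y} \<inter> V = {}\<rbrakk>
    \<Longrightarrow> family_F (V \<union> {x, y}) (E \<union> {{v, x}, {v, y}})"
| O4: "\<lbrakk>family_F V E; v \<in> V; deg E v \<ge> 2; distinct [x, y, z]; {x, y, z} \<inter> V = {}\<rbrakk>
    \<Longrightarrow> family_F (V \<union> {x, y, z}) (E \<union> {{x, y}, {y, z}, {v, y}})"
| O5: "\<lbrakk>family_F V E; v \<in> V; deg E v \<ge> 2; distinct [u1, v1, v2, v3, v4, u3];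
      {u1, v1, v2, v3, v4, u3} \<inter> V = {}\<rbrakk>
    \<Longrightarrow> family_F (V \<union> {u1, v1, v2, v3, v4, u3})
         (E \<union> {{u1, v1}, {v1, v2}, {v2, v3}, {v3, v4}, {v3, u3}, {v, v1}})"

end

theory Submission
  imports Defs
begin

text \<open>
  If a total forcing set \<open>S\<close> forces all of \<open>V\<close>, then every vertex forces at most one other and
  leaves force nothing, so \<open>|V| - |S| \<le> |V| - n\<^sub>1\<close>. Equality means that every vertex that is not
  a leaf forces exactly one neighbor; such a ``forcing map'' \<open>f\<close> is injective, has no 2-cycles,
  and its sources \<open>V - f ` (V - leaves)\<close> have source neighbors. In a tree these local conditions
  suffice for the sources to form a forcing set, whatever order the forcing process takes, so the
  process can be forgotten. The five operations extend forcing maps. Conversely, take a tree with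
  a forcing map, rooted at a leaf, and a deepest vertex \<open>x\<close> with ancestors \<open>c\<close>, \<open>q\<close>, \<open>s\<close>, \<open>t\<close>. Unless
  O1 or O2 can be undone, \<open>c\<close> has degree 3 and two leaf children. If \<open>q\<close> has degree at least 3,
  then O3 can be undone at \<open>c\<close> or O4 at a child of \<open>q\<close>. Otherwise \<open>f q = s\<close>, and either O4 can be
  undone at another child of \<open>s\<close>, or \<open>s\<close> has neighbors \<open>q\<close>, \<open>t\<close> and one leaf, and O5 can be undone
  at \<open>t\<close>.
\<close>

subsection \<open>Neighbourhoods\<close>

text \<open>The exclusion of 2-cycles is all that a forcing map keeps of the order of forcing: in a
  tree, vertices waiting for each other in a circle would have to turn back along an edge. Undoing
  an operation must leave a forcing map on the smaller tree. Restricting \<open>f\<close> to what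
  remains can fail in three ways: \<open>f\<close> crosses the cut edge, a source loses its last
  source neighbor, or the attaching vertex becomes a leaf. The last one is why attaching vertices of
  degree at least 3 are sought. The first two are controlled by one observation: a vertex with two
  leaf neighbors forces at most one of them, the other is a source, and its only neighbor must then
  be a source as well. So \<open>c\<close> is a source and \<open>q\<close> never forces it. This
  gives \<open>f q = s\<close> when \<open>q\<close> has degree 2; when \<open>q\<close> has larger
  degree, it reduces the analysis to whether \<open>c\<close> forces \<open>q\<close> and whether
  \<open>q\<close> is a source. Rooting at a leaf gives every other vertex that matters a parent,
  and no reduction removes the root or changes its degree.\<close>

lemma nbrs_sym: "u \<in> nbrs E v \<longleftrightarrow> v \<in> nbrs E u"
  by (simp add: nbrs_def insert_commute)

lemma nbrs_insert:
  "nbrs (insert {a, b} E) x =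
     (if x = a then {b} else {}) \<union> (if x = b then {a} else {}) \<union> nbrs E x"
  by (auto simp: nbrs_def doubleton_eq_iff)

lemma nbrs_Un: "nbrs (E \<union> F) x = nbrs E x \<union> nbrs F x"
  by (auto simp: nbrs_def)

lemma nbrs_empty [simp]: "nbrs {} x = {}"
  by (simp add: nbrs_def)

lemma nbrsD:
  assumes "simple_graph V E" "u \<in> nbrs E v"
  shows "u \<in> V" "v \<in> V" "u \<noteq> v"
proof -
  from assms have "{v, u} \<subseteq> V" "card {v, u} = 2"
    by (auto simp: simple_graph_def nbrs_def)
  then show "u \<in> V" "v \<in> V" "u \<noteq> v"
    by auto
qed

lemma nbrs_outside: "simple_graph V E \<Longrightarrow> v \<notin> V \<Longrightarrow> nbrs E v = {}"
  using nbrsD(2) by fastforce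

lemma finite_nbrs: "simple_graph V E \<Longrightarrow> finite (nbrs E v)"
  using nbrsD(1) by (metis finite_subset simple_graph_def subsetI)

lemma edge_cases:
  assumes "simple_graph V E" "e \<in> E"
  obtains a b where "e = {a, b}" "a \<noteq> b" "a \<in> V" "b \<in> V" "b \<in> nbrs E a"
proof -
  from assms have "card e = 2" "e \<subseteq> V" by (auto simp: simple_graph_def)
  then obtain a b where "e = {a, b}" "a \<noteq> b" by (auto simp: card_2_iff)
  with \<open>e \<subseteq> V\<close> \<open>e \<in> E\<close> show ?thesis by (intro that) (auto simp: nbrs_def)
qed

lemma leaves_iff: "v \<in> leaves V E \<longleftrightarrow> v \<in> V \<and> (\<exists>u. nbrs E v = {u})"
  by (auto simp: leaves_def deg_def card_1_singleton_iff)

lemma card_ge_2_other: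
  assumes "card A \<ge> 2"
  shows "\<exists>y\<in>A. y \<noteq> x"
proof (rule ccontr)
  assume "\<not> ?thesis"
  then have "A \<subseteq> {x}" by blast
  then have "card A \<le> 1" using card_mono[of "{x}" A] by simp
  with assms show False by simp
qed

lemma card_ge_3_other:
  assumes "card A \<ge> 3"
  shows "\<exists>z\<in>A. z \<noteq> x \<and> z \<noteq> y"
proof (rule ccontr)
  assume "\<not> ?thesis"
  then have "A \<subseteq> {x, y}" by blast
  then have "card A \<le> card {x, y}" by (intro card_mono) auto
  also have "\<dots> \<le> 2" by (simp add: card_insert_if)
  finally show False using assms by simp
qed

lemma leaf_nbrs:
  assumes "v \<in> leaves V E" "u \<in> nbrs E v"
  shows "nbrs E v = {u}"
  using assms by (auto simp: leaves_iff)

subsection \<open>Forcing maps\<close>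

definition inner :: "'a set \<Rightarrow> 'a set set \<Rightarrow> 'a set" where
  "inner V E = V - leaves V E"

definition sources :: "'a set \<Rightarrow> 'a set set \<Rightarrow> ('a \<Rightarrow> 'a) \<Rightarrow> 'a set" where
  "sources V E f = V - f ` inner V E"

text \<open>
  A total forcing set with as many elements as there are leaves is recorded by the map sending
  every vertex that is not a leaf to the vertex that it forces; the set itself consists of the
  vertices that are not forced.
\<close>

definition forcing_map :: "'a set \<Rightarrow> 'a set set \<Rightarrow> ('a \<Rightarrow> 'a) \<Rightarrow> bool" where
  "forcing_map V E f \<longleftrightarrow>
     inj_on f (inner V E) \<and> (\<forall>x\<in>inner V E. f x \<in> nbrs E x) \<and>
     (\<forall>x\<in>inner V E. f x \<in> inner V E \<longrightarrow> f (f x) \<noteq> x) \<and>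
     (\<forall>s\<in>sources V E f. \<exists>t\<in>sources V E f. t \<in> nbrs E s)"

lemma inner_subset: "inner V E \<subseteq> V"
  by (auto simp: inner_def)

lemma forcing_mapI:
  assumes "inj_on f (inner V E)"
    and "\<And>x. x \<in> inner V E \<Longrightarrow> f x \<in> nbrs E x"
    and "\<And>x. x \<in> inner V E \<Longrightarrow> f x \<in> inner V E \<Longrightarrow> f (f x) \<noteq> x"
    and "\<And>s. s \<in> sources V E f \<Longrightarrow> \<exists>t\<in>sources V E f. t \<in> nbrs E s"
  shows "forcing_map V E f"
  using assms by (simp add: forcing_map_def)

lemma forcing_mapD:
  assumes "forcing_map V E f"
  shows "inj_on f (inner V E)"
    and "\<And>x. x \<in> inner V E \<Longrightarrow> f x \<in> nbrs E x"
    and "\<And>x. x \<in> inner V E \<Longrightarrow> f x \<in> inner V E \<Longrightarrow> f (f x) \<noteq> x"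
    and "\<And>s. s \<in> sources V E f \<Longrightarrow> \<exists>t\<in>sources V E f. t \<in> nbrs E s"
  using assms by (auto simp: forcing_map_def)

lemma card_sources:
  assumes "simple_graph V E" "forcing_map V E f"
  shows "card (sources V E f) = card (leaves V E)"
proof -
  have fin: "finite V" using assms(1) by (simp add: simple_graph_def)
  have sub: "f ` inner V E \<subseteq> V"
    using forcing_mapD(2)[OF assms(2)] nbrsD(1)[OF assms(1)] by blast
  have L: "leaves V E \<subseteq> V" by (auto simp: leaves_def)
  have "card (sources V E f) = card V - card (f ` inner V E)"
    unfolding sources_def by (rule card_Diff_subset[OF finite_subset[OF sub fin] sub])
  also have "card (f ` inner V E) = card (inner V E)"
    by (rule card_image[OF forcing_mapD(1)[OF assms(2)]])
  also have "card (inner V E) = card V - card (leaves V E)"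
    unfolding inner_def by (rule card_Diff_subset[OF finite_subset[OF L fin] L])
  also have "card V - \<dots> = card (leaves V E)"
    using card_mono[OF fin L] by simp
  finally show ?thesis .
qed

text \<open>The record of a run from \<open>S\<close> that has colored \<open>X\<close> so far:
  \<open>D\<close> holds the vertices that have forced, and \<open>f\<close> tells what they forced.
  The clause \<open>nbrs E x \<subseteq> X\<close> expresses that a vertex has nothing left to force
  afterwards.\<close>

definition partial_forcing_map ::
    "'a set \<Rightarrow> 'a set set \<Rightarrow> 'a set \<Rightarrow> 'a set \<Rightarrow> 'a set \<Rightarrow> ('a \<Rightarrow> 'a) \<Rightarrow> bool" where
  "partial_forcing_map V E S X D f \<longleftrightarrow>
     D \<subseteq> inner V E \<and> D \<subseteq> X \<and> (\<forall>x\<in>D. nbrs E x \<subseteq> X \<and> f x \<in> nbrs E x) \<and>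
     inj_on f D \<and> f ` D = X - S \<and> (\<forall>x\<in>D. f x \<in> D \<longrightarrow> f (f x) \<noteq> x)"

text \<open>
  A vertex that forces has a colored neighbor besides the one it forces, as no colored vertex is
  ever isolated among the colored ones; hence leaves never force.
\<close>

lemma partial_forcing_map_of_steps:
  assumes "(force_step E)\<^sup>*\<^sup>* S X"
    and "simple_graph V E" "S \<subseteq> V" and tot: "\<And>s. s \<in> S \<Longrightarrow> nbrs E s \<inter> S \<noteq> {}"
  shows "X \<subseteq> V \<and> S \<subseteq> X \<and> (\<forall>x\<in>X. nbrs E x \<inter> X \<noteq> {}) \<and>
    (\<exists>D f. partial_forcing_map V E S X D f)"
  using assms(1)
proof (induction rule: rtranclp_induct)
  case base
  have "partial_forcing_map V E S S {} f" for f
    by (simp add: partial_forcing_map_def)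
  then show ?case using assms(3) tot by blast
next
  case (step X Y)
  from step.IH obtain D f where "partial_forcing_map V E S X D f"
    and X: "X \<subseteq> V" "S \<subseteq> X" "\<And>x. x \<in> X \<Longrightarrow> nbrs E x \<inter> X \<noteq> {}"
    by blast
  then have D: "D \<subseteq> inner V E" "D \<subseteq> X"
      "\<And>x. x \<in> D \<Longrightarrow> nbrs E x \<subseteq> X" "\<And>x. x \<in> D \<Longrightarrow> f x \<in> nbrs E x" "inj_on f D"
      "f ` D = X - S" "\<And>x. x \<in> D \<Longrightarrow> f x \<in> D \<Longrightarrow> f (f x) \<noteq> x"
    by (simp_all add: partial_forcing_map_def)
  from step.hyps(2) obtain v w where v: "v \<in> X" "nbrs E v - X = {w}" and Y: "Y = insert w X"
    by cases auto
  have w: "w \<in> nbrs E v" "w \<notin> X" using v(2) by auto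
  \<comment> \<open>No vertex forces twice, so \<open>f\<close> may be redefined at
    \<open>v\<close>.\<close>
  have vD: "v \<notin> D" using D(3) w by blast
  have "v \<notin> leaves V E"
  proof
    assume "v \<in> leaves V E"
    then have "nbrs E v = {w}" using w(1) by (rule leaf_nbrs)
    with X(3)[OF v(1)] w(2) show False by auto
  qed
  with v(1) X(1) have vi: "v \<in> inner V E" by (auto simp: inner_def)
  define g where "g = f(v := w)"
  have gD: "g x = f x" if "x \<in> D" for x using that vD by (auto simp: g_def)
  have gv: "g v = w" by (simp add: g_def)
  have im: "g ` D = X - S" using D(6) gD by (metis image_cong)
  have "inj_on g D" using D(5) gD by (metis inj_on_cong)
  moreover have "w \<notin> g ` D" using im w(2) by auto
  ultimately have "inj_on g (insert v D)" using gv vD by simp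
  moreover have "g ` insert v D = Y - S" using im gv Y w(2) X(2) by auto
  \<comment> \<open>The vertex \<open>w\<close> has only just been colored: it has forced nothing
    yet, so the new arrow from \<open>v\<close> to \<open>w\<close> closes no 2-cycle.\<close>
  moreover have "g (g x) \<noteq> x" if x: "x \<in> insert v D" "g x \<in> insert v D" for x
  proof (cases "x = v")
    case True
    then show ?thesis using x(2) gv v(1) w(2) D(2) by auto
  next
    case False
    then have "x \<in> D" using x(1) by simp
    show ?thesis
    proof (cases "g x = v")
      case True
      then show ?thesis using gv w(2) \<open>x \<in> D\<close> D(2) by auto
    next
      case False
      then have "f x \<in> D" using x(2) gD[OF \<open>x \<in> D\<close>] by simp
      then show ?thesis using D(7)[OF \<open>x \<in> D\<close>] gD \<open>x \<in> D\<close> by simp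
    qed
  qed
  moreover have "\<forall>x\<in>insert v D. nbrs E x \<subseteq> Y \<and> g x \<in> nbrs E x"
    using D(3,4) v(2) Y gv gD w by auto
  moreover have "insert v D \<subseteq> inner V E" "insert v D \<subseteq> Y"
    using D(1,2) vi v(1) Y by auto
  ultimately have "partial_forcing_map V E S Y (insert v D) g"
    unfolding partial_forcing_map_def by blast
  moreover have "Y \<subseteq> V" using X(1) Y nbrsD(1)[OF assms(2) w(1)] by simp
  moreover have "\<forall>x\<in>Y. nbrs E x \<inter> Y \<noteq> {}"
    using X(3) v(1) w(1) Y nbrs_sym[of w E v] by auto
  ultimately show ?case using X(2) Y by auto
qed

lemma total_forcing_set_iff:
  assumes "simple_graph V E"
  shows "total_forcing_set V E S \<longleftrightarrow>
    S \<subseteq> V \<and> (force_step E)\<^sup>*\<^sup>* S V \<and> (\<forall>s\<in>S. nbrs E s \<inter> S \<noteq> {})"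
proof -
  have "deg (induced_edges E S) s \<noteq> 0 \<longleftrightarrow> nbrs E s \<inter> S \<noteq> {}" if "s \<in> S" for s
  proof -
    have eq: "nbrs (induced_edges E S) s = nbrs E s \<inter> S"
      using that by (auto simp: nbrs_def induced_edges_def)
    have "finite (nbrs E s \<inter> S)" using finite_nbrs[OF assms] by blast
    then show ?thesis by (simp add: deg_def eq)
  qed
  then show ?thesis by (auto simp: total_forcing_set_def forcing_set_def)
qed

lemma total_forcing_set_ge:
  assumes "simple_graph V E" "total_forcing_set V E S"
  shows "card (leaves V E) \<le> card S"
    and "card S = card (leaves V E) \<Longrightarrow> \<exists>f. forcing_map V E f"
proof -
  have fin: "finite V" using assms(1) by (simp add: simple_graph_def)
  have S: "S \<subseteq> V" "(force_step E)\<^sup>*\<^sup>* S V" "\<And>s. s \<in> S \<Longrightarrow> nbrs E s \<inter> S \<noteq> {}"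
    using assms by (auto simp: total_forcing_set_iff)
  from partial_forcing_map_of_steps[OF S(2) assms(1) S(1,3)]
  obtain D f where "partial_forcing_map V E S V D f" by blast
  then have D: "D \<subseteq> inner V E" "\<And>x. x \<in> D \<Longrightarrow> f x \<in> nbrs E x" "inj_on f D"
      "f ` D = V - S" "\<And>x. x \<in> D \<Longrightarrow> f x \<in> D \<Longrightarrow> f (f x) \<noteq> x"
    by (simp_all add: partial_forcing_map_def)
  have L: "leaves V E \<subseteq> V" by (auto simp: leaves_def)
  have fi: "finite (inner V E)" using inner_subset fin by (rule finite_subset)
  have ci: "card (inner V E) = card V - card (leaves V E)"
    unfolding inner_def by (rule card_Diff_subset[OF finite_subset[OF L fin] L])
  have cD: "card D = card V - card S"
    using card_image[OF D(3)] D(4) card_Diff_subset[OF finite_subset[OF S(1) fin] S(1)] by simp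
  have le: "card D \<le> card (inner V E)" by (rule card_mono[OF fi D(1)])
  have leV: "card (leaves V E) \<le> card V" "card S \<le> card V"
    using card_mono[OF fin] L S(1) by auto
  show "card (leaves V E) \<le> card S" using ci cD le leV by linarith
  show "\<exists>f. forcing_map V E f" if "card S = card (leaves V E)"
  proof -
    have "card D = card (inner V E)" using that ci cD by simp
    \<comment> \<open>Equality in the count leaves no vertex idle except the leaves.\<close>
    then have Di: "D = inner V E" using card_subset_eq[OF fi D(1)] by simp
    have "sources V E f = S" using D(4) S(1) by (auto simp: sources_def Di)
    then have "forcing_map V E f"
      using D(2,3,5) S(3) unfolding Di by (intro forcing_mapI) blast+
    then show ?thesis by blast
  qed
qed

subsection \<open>Rooted trees\<close>

text \<open>
  The rank \<open>d\<close> only decreases towards the root and need not be the depth, so that it survives the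
  contraction of an edge.
\<close>

definition rooted :: "'a set \<Rightarrow> 'a set set \<Rightarrow> 'a \<Rightarrow> ('a \<Rightarrow> 'a) \<Rightarrow> ('a \<Rightarrow> nat) \<Rightarrow> bool" where
  "rooted V E r p d \<longleftrightarrow> finite V \<and> r \<in> V \<and> (\<forall>v\<in>V - {r}. p v \<in> V \<and> d (p v) < d v) \<and>
     E = (\<lambda>v. {v, p v}) ` (V - {r})"

lemma rooted_simple:
  assumes "rooted V E r p d"
  shows "simple_graph V E"
proof -
  have "{v, p v} \<subseteq> V \<and> card {v, p v} = 2" if "v \<in> V - {r}" for v
  proof -
    have "p v \<in> V" "d (p v) < d v" using assms that by (auto simp: rooted_def)
    then show ?thesis using that by (cases "p v = v") auto
  qed
  then show ?thesis using assms by (auto simp: rooted_def simple_graph_def)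
qed

lemma rooted_parent:
  "rooted V E r p d \<Longrightarrow> v \<in> V \<Longrightarrow> v \<noteq> r \<Longrightarrow> p v \<in> V \<and> d (p v) < d v \<and> p v \<in> nbrs E v"
  by (auto simp: rooted_def nbrs_def)

lemma rooted_nbrs:
  assumes "rooted V E r p d"
  shows "u \<in> nbrs E v \<longleftrightarrow> (v \<in> V \<and> v \<noteq> r \<and> u = p v) \<or> (u \<in> V \<and> u \<noteq> r \<and> v = p u)"
  using assms by (auto simp: rooted_def nbrs_def doubleton_eq_iff)

text \<open>A non-backtracking walk in a rooted tree that once steps away from the root can only go
  on away from it, and one that never does climbs towards the root; either way it ends. The walk is
  given by a set \<open>P\<close> of directed edges in which each has a successor, so that no
  infinite sequence has to be chosen.\<close>

lemma no_infinite_walk: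
  assumes "rooted V E r p d" "P \<noteq> {}"
    and P: "\<And>a b. (a, b) \<in> P \<Longrightarrow> b \<in> nbrs E a"
    and succ: "\<And>a b. (a, b) \<in> P \<Longrightarrow> \<exists>c. (b, c) \<in> P \<and> c \<noteq> a"
  shows False
proof (cases "\<exists>(a, b) \<in> P. a = p b \<and> b \<in> V \<and> b \<noteq> r")
  case True
  \<comment> \<open>Take the downward step whose end has the largest rank; its successor is a
    downward step to a still larger rank.\<close>
  define B where "B = {b. (p b, b) \<in> P \<and> b \<in> V \<and> b \<noteq> r}"
  have "finite B" using assms(1) by (auto simp: B_def rooted_def intro: rev_finite_subset)
  moreover have "B \<noteq> {}" using True by (auto simp: B_def)
  ultimately obtain b where b: "b \<in> B" "\<And>c. c \<in> B \<Longrightarrow> d c \<le> d b"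
    using Max_in[of "d ` B"] Max_ge[of "d ` B"] by fastforce
  from b(1) have "(p b, b) \<in> P" "b \<in> V" "b \<noteq> r" by (auto simp: B_def)
  from succ[OF this(1)] obtain c where c: "(b, c) \<in> P" "c \<noteq> p b" by auto
  from P[OF c(1)] c(2) have "c \<in> V" "c \<noteq> r" "b = p c"
    by (auto simp: rooted_nbrs[OF assms(1)])
  then have "c \<in> B" "d b < d c"
    using c(1) rooted_parent[OF assms(1)] by (auto simp: B_def)
  with b(2) show False by fastforce
next
  case False
  \<comment> \<open>Now every step climbs, so a starting point of least rank has a successor
    starting lower.\<close>
  then have up: "a \<in> V \<and> a \<noteq> r \<and> b = p a" if "(a, b) \<in> P" for a b
    using P[OF that] that by (auto simp: rooted_nbrs[OF assms(1)])
  from assms(2) have "\<exists>a. a \<in> fst ` P" by auto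
  then obtain a where a: "a \<in> fst ` P" "\<And>c. c \<in> fst ` P \<Longrightarrow> d a \<le> d c"
    using exists_least_iff[of "\<lambda>n. \<exists>a. a \<in> fst ` P \<and> d a = n"] by (metis not_le)
  then obtain b where "(a, b) \<in> P" by auto
  then have "b = p a" "d (p a) < d a" using up rooted_parent[OF assms(1)] by blast+
  moreover obtain c where "(b, c) \<in> P" using succ \<open>(a, b) \<in> P\<close> by blast
  ultimately show False using a(2)[of b] by force
qed

lemma force_steps_of_progress:
  assumes "finite V" "S \<subseteq> V"
    and prog: "\<And>X. S \<subseteq> X \<Longrightarrow> X \<subset> V \<Longrightarrow> \<exists>x\<in>X. \<exists>u\<in>V. nbrs E x - X = {u}"
  shows "(force_step E)\<^sup>*\<^sup>* S V"
proof -
  have "(force_step E)\<^sup>*\<^sup>* X V" if "S \<subseteq> X" "X \<subseteq> V" for X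
    using that
  proof (induction "card (V - X)" arbitrary: X rule: less_induct)
    case less
    show ?case
    proof (cases "X = V")
      case False
      then obtain x u where x: "x \<in> X" "u \<in> V" "nbrs E x - X = {u}"
        using prog[of X] less.prems by blast
      then have "V - insert u X \<subset> V - X" by auto
      then have "card (V - insert u X) < card (V - X)"
        using assms(1) by (intro psubset_card_mono) auto
      then have "(force_step E)\<^sup>*\<^sup>* (insert u X) V"
        using less x(2) by auto
      then show ?thesis
        using force_step.intros[OF x(1,3)] by (rule converse_rtranclp_into_rtranclp[rotated])
    qed simp
  qed
  then show ?thesis using assms(2) by blast
qed

text \<open>
  If the coloring stalled at \<open>X\<close>, then one could walk forever without backtracking: from a
  vertex outside \<open>X\<close> to the vertex forcing it, and from a vertex of \<open>X\<close> to an uncolored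
  neighbor that it does not force.
\<close>

lemma forcing_map_forces:
  assumes T: "rooted V E r p d" and f: "forcing_map V E f"
  shows "total_forcing_set V E (sources V E f)"
proof -
  note sg = rooted_simple[OF T]
  have fin: "finite V" using T by (simp add: rooted_def)
  let ?S = "sources V E f"
  have S: "?S \<subseteq> V" by (auto simp: sources_def)
  have "\<exists>x\<in>X. \<exists>u\<in>V. nbrs E x - X = {u}" if X: "?S \<subseteq> X" "X \<subset> V" for X
  proof (rule ccontr)
    assume stall: "\<not> ?thesis"
    have pre: "\<exists>y\<in>inner V E. f y = u" if "u \<in> V" "u \<notin> X" for u
      using that X(1) by (auto simp: sources_def)
    define P where "P = {(x, u). x \<in> X \<and> u \<in> nbrs E x \<and> u \<notin> X \<and> \<not> (x \<in> inner V E \<and> f x = u)} \<union>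
      {(u, x). x \<in> inner V E \<and> f x = u \<and> u \<notin> X}"
    have "\<exists>u\<in>V. u \<notin> X" using X(2) by auto
    then have "P \<noteq> {}" using pre by (fastforce simp: P_def)
    moreover have "b \<in> nbrs E a" if "(a, b) \<in> P" for a b
      using that forcing_mapD(2)[OF f, of b] by (auto simp: P_def nbrs_sym[of b])
    moreover have "\<exists>c. (b, c) \<in> P \<and> c \<noteq> a" if ab: "(a, b) \<in> P" for a b
      using ab[unfolded P_def]
    proof (elim UnE)
      assume "(a, b) \<in> {(x, u). x \<in> X \<and> u \<in> nbrs E x \<and> u \<notin> X \<and> \<not> (x \<in> inner V E \<and> f x = u)}"
      then have a: "a \<in> X" "b \<in> nbrs E a" "b \<notin> X" "\<not> (a \<in> inner V E \<and> f a = b)" by auto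
      then obtain y where "y \<in> inner V E" "f y = b" using pre nbrsD(1)[OF sg a(2)] by blast
      with a show ?thesis by (intro exI[of _ y]) (auto simp: P_def)
    next
      assume "(a, b) \<in> {(u, x). x \<in> inner V E \<and> f x = u \<and> u \<notin> X}"
      then have b: "b \<in> inner V E" "f b = a" "a \<notin> X" by auto
      have an: "a \<in> nbrs E b" using forcing_mapD(2)[OF f b(1)] b(2) by simp
      show ?thesis
      proof (cases "b \<in> X")
        case True
        \<comment> \<open>The colored vertex \<open>b\<close> is stalled, so besides the vertex
          \<open>a\<close> that it is meant to force it has another uncolored neighbor.\<close>
        then have "nbrs E b - X \<noteq> {a}" using stall nbrsD(1)[OF sg an] by blast
        then obtain u where "u \<in> nbrs E b" "u \<notin> X" "u \<noteq> a" using an b(3) by blast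
        with True b show ?thesis by (intro exI[of _ u]) (auto simp: P_def)
      next
        case False
        then obtain y where y: "y \<in> inner V E" "f y = b"
          using pre[of b] b(1) inner_subset[of V E] by blast
        \<comment> \<open>Turning back here would mean that \<open>a\<close> and \<open>b\<close>
          force each other; this is the use of the condition on 2-cycles.\<close>
        then have "y \<noteq> a" using forcing_mapD(3)[OF f y(1)] b(1,2) y(2) by simp
        with y False show ?thesis by (intro exI[of _ y]) (auto simp: P_def)
      qed
    qed
    ultimately show False by (rule no_infinite_walk[OF T])
  qed
  then have "(force_step E)\<^sup>*\<^sup>* ?S V" by (rule force_steps_of_progress[OF fin S])
  then show ?thesis
    using S forcing_mapD(4)[OF f] by (auto simp: total_forcing_set_iff[OF sg])
qed

section \<open>Leaves of trees, and rooting a tree at a given vertex\<close>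

lemma connected_nbrs_nonempty:
  assumes "connected_graph V E" "card V \<ge> 2" "x \<in> V"
  shows "nbrs E x \<noteq> {}"
proof -
  obtain y where "y \<in> V" "y \<noteq> x" using card_ge_2_other[OF assms(2)] by blast
  then have "(\<lambda>x y. {x, y} \<in> E)\<^sup>*\<^sup>* x y" using assms by (auto simp: connected_graph_def)
  then show ?thesis
    using \<open>y \<noteq> x\<close> by (cases rule: converse_rtranclpE) (auto simp: nbrs_def)
qed

text \<open>The end of a longest path starting at \<open>r\<close> is a leaf.\<close>

lemma tree_leaf:
  assumes T: "tree V E" and card: "card V \<ge> 2" and r: "r \<in> V"
  shows "\<exists>l\<in>leaves V E. l \<noteq> r"
proof -
  have sg: "simple_graph V E" and con: "connected_graph V E" and acyc: "\<nexists>c. is_cycle E c"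
    using T by (auto simp: tree_def)
  have fin: "finite V" using sg by (simp add: simple_graph_def)
  define path where "path c \<longleftrightarrow> c \<noteq> [] \<and> hd c = r \<and> distinct c \<and> set c \<subseteq> V \<and>
    (\<forall>i. Suc i < length c \<longrightarrow> {c ! i, c ! Suc i} \<in> E)" for c
  obtain y where y: "y \<in> nbrs E r" using connected_nbrs_nonempty[OF con card r] by blast
  \<comment> \<open>This path ensures that a longest one has at least two vertices and does not end
    at \<open>r\<close>.\<close>
  have path2: "path [r, y]"
    using y nbrsD[OF sg y] by (auto simp: path_def nbrs_def less_Suc_eq)
  have bound: "length c < Suc (card V)" if "path c" for c
    using that card_mono[OF fin, of "set c"] by (auto simp: path_def distinct_card)
  obtain c where c: "path c" and max: "\<And>c'. path c' \<Longrightarrow> length c' \<le> length c"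
    using ex_has_greatest_nat[of path "[r, y]" length "Suc (card V)"] path2 bound by blast
  from max[OF path2] have len: "length c \<ge> 2" by simp
  from c have cd: "c \<noteq> []" "hd c = r" "distinct c" "set c \<subseteq> V"
    and ce: "\<And>i. Suc i < length c \<Longrightarrow> {c ! i, c ! Suc i} \<in> E"
    by (auto simp: path_def)
  define n where "n = length c - 2"
  have n: "length c = Suc (Suc n)" using len by (simp add: n_def)
  have last: "last c = c ! Suc n" using cd(1) n by (simp add: last_conv_nth)
  have "nbrs E (last c) = {c ! n}"
  proof
    show "{c ! n} \<subseteq> nbrs E (last c)"
      using ce[of n] n last by (auto simp: nbrs_def insert_commute)
    show "nbrs E (last c) \<subseteq> {c ! n}"
    proof
      fix u assume u: "u \<in> nbrs E (last c)"
      have "u \<in> set c"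
      proof (rule ccontr)
        assume "u \<notin> set c"
        moreover have "{(c @ [u]) ! i, (c @ [u]) ! Suc i} \<in> E" if "Suc i < length (c @ [u])" for i
        proof (cases "Suc i < length c")
          case True
          then show ?thesis using ce[of i] by (simp add: nth_append)
        next
          case False
          then have "i = Suc n" using that n by simp
          then show ?thesis using u last n by (simp add: nth_append nbrs_def)
        qed
        ultimately have "path (c @ [u])"
          using cd nbrsD(1)[OF sg u] by (auto simp: path_def)
        from max[OF this] show False by simp
      qed
      then obtain i where i: "i < length c" "u = c ! i" by (auto simp: in_set_conv_nth)
      have "i \<noteq> Suc n" using i nbrsD(3)[OF sg u] last by auto
      \<comment> \<open>A neighbor of the end that lies earlier on the path than its predecessor
        would close the cycle \<open>drop i c\<close>.\<close>
      moreover have "\<not> i < n"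
      proof
        assume "i < n"
        have "is_cycle E (drop i c)"
          unfolding is_cycle_def
        proof (intro conjI allI impI)
          show "3 \<le> length (drop i c)" using \<open>i < n\<close> n by simp
          show "distinct (drop i c)" using cd(3) by simp
          show "{drop i c ! j, drop i c ! Suc j} \<in> E" if "Suc j < length (drop i c)" for j
            using ce[of "i + j"] that by simp
          show "{last (drop i c), hd (drop i c)} \<in> E"
            using u i by (simp add: hd_drop_conv_nth nbrs_def)
        qed
        then show False using acyc by blast
      qed
      ultimately have "i = n" using i n by simp
      then show "u \<in> {c ! n}" using i by simp
    qed
  qed
  moreover have "last c \<in> V" using cd by auto
  moreover have "last c \<noteq> r"
    using cd(1-3) n last by (cases c) (auto simp: nth_Cons')
  ultimately show ?thesis by (auto simp: leaves_iff)
qed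

lemma tree_remove_leaf:
  assumes T: "tree V E" and l: "l \<in> V" "nbrs E l = {u}"
  shows "tree (V - {l}) (E - {{l, u}})"
proof -
  have sg: "simple_graph V E" and con: "connected_graph V E" and acyc: "\<nexists>c. is_cycle E c"
    using T by (auto simp: tree_def)
  have u: "u \<in> V" "u \<noteq> l" using nbrsD[OF sg, of u l] l(2) by auto
  have "e \<subseteq> V - {l} \<and> card e = 2" if e: "e \<in> E - {{l, u}}" for e
  proof -
    from e have "e \<in> E" by simp
    then obtain a b where ab: "e = {a, b}" "b \<in> nbrs E a" "e \<subseteq> V" "card e = 2"
      using edge_cases[OF sg] sg unfolding simple_graph_def by metis
    have "l \<notin> e"
    proof
      assume "l \<in> e"
      then have "e = {l, u}" using ab l(2) nbrs_sym[of b E a] by auto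
      then show False using e by simp
    qed
    then show ?thesis using ab by auto
  qed
  then have "simple_graph (V - {l}) (E - {{l, u}})"
    using sg by (auto simp: simple_graph_def)
  moreover have "connected_graph (V - {l}) (E - {{l, u}})"
    unfolding connected_graph_def
  proof (intro conjI ballI)
    show "V - {l} \<noteq> {}" using u by auto
    let ?R = "\<lambda>x y. {x, y} \<in> E - {{l, u}}"
    fix x y assume x: "x \<in> V - {l}" and y: "y \<in> V - {l}"
    have "(\<lambda>x y. {x, y} \<in> E)\<^sup>*\<^sup>* x y" using x y con by (auto simp: connected_graph_def)
    \<comment> \<open>A walk enters and leaves \<open>l\<close> only through \<open>u\<close>, so
      each visit to \<open>l\<close> is replaced by waiting at \<open>u\<close>.\<close>
    then have "?R\<^sup>*\<^sup>* x (if y = l then u else y)"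
    proof (induction rule: rtranclp_induct)
      case base
      then show ?case using x by simp
    next
      case (step y z)
      consider "y = l" | "z = l" | "y \<noteq> l" "z \<noteq> l" by blast
      then show ?case
      proof cases
        case 1
        then have "z = u" using step.hyps(2) l(2) by (auto simp: nbrs_def)
        then show ?thesis using 1 step.IH u by simp
      next
        case 2
        then have "y \<in> nbrs E l" using step.hyps(2) by (simp add: nbrs_def insert_commute)
        then have "y = u" using l(2) by simp
        then show ?thesis using 2 step.IH u by simp
      next
        case 3
        then have "?R y z" using step.hyps(2) by (auto simp: doubleton_eq_iff)
        then show ?thesis using 3 step.IH by (simp add: rtranclp.rtrancl_into_rtrancl)
      qed
    qed
    then show "?R\<^sup>*\<^sup>* x y" using y by simp
  qed
  moreover have "\<nexists>c. is_cycle (E - {{l, u}}) c"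
    using acyc unfolding is_cycle_def by blast
  ultimately show ?thesis by (simp add: tree_def)
qed

text \<open>Peel off a leaf other than \<open>r\<close>, root the rest, and hang the leaf below its
  only neighbor with a rank one larger.\<close>

lemma tree_rooted:
  assumes "tree V E" "r \<in> V"
  shows "\<exists>p d. rooted V E r p d"
  using assms
proof (induction "card V" arbitrary: V E rule: less_induct)
  case less
  have sg: "simple_graph V E" using less.prems by (simp add: tree_def)
  have fin: "finite V" using sg by (simp add: simple_graph_def)
  show ?case
  proof (cases "card V \<ge> 2")
    case False
    have V: "V = {r}"
      using False card_le_Suc0_iff_eq[OF fin] less.prems(2) by auto
    have "E = {}"
    proof (rule ccontr)
      assume "E \<noteq> {}"
      then obtain e where "e \<in> E" by blast
      from edge_cases[OF sg this] V show False by auto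
    qed
    with V have "rooted V E r undefined undefined" by (simp add: rooted_def)
    then show ?thesis by blast
  next
    case True
    obtain l where l: "l \<in> leaves V E" "l \<noteq> r"
      using tree_leaf[OF less.prems(1) True less.prems(2)] by blast
    then obtain u where u: "l \<in> V" "nbrs E l = {u}" by (auto simp: leaves_iff)
    then have uV: "u \<in> V" "u \<noteq> l" "{l, u} \<in> E"
      using nbrsD[OF sg, of u l] by (auto simp: nbrs_def)
    have "card (V - {l}) < card V" using u(1) fin by (metis card_Diff1_less)
    from less.hyps[OF this tree_remove_leaf[OF less.prems(1) u]] obtain p d
      where pd: "rooted (V - {l}) (E - {{l, u}}) r p d"
      using l(2) less.prems(2) by auto
    have "E = insert {l, u} (E - {{l, u}})" using uV by auto
    also have "E - {{l, u}} = (\<lambda>v. {v, p v}) ` (V - {l} - {r})"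
      using pd by (simp add: rooted_def)
    also have "\<dots> = (\<lambda>v. {v, (p(l := u)) v}) ` (V - {l} - {r})"
      by (rule image_cong) auto
    also have "insert {l, u} \<dots> = (\<lambda>v. {v, (p(l := u)) v}) ` (V - {r})"
    proof -
      have "V - {r} = insert l (V - {l} - {r})" using u(1) l(2) by auto
      then show ?thesis by (simp only: image_insert fun_upd_same)
    qed
    finally have E: "E = (\<lambda>v. {v, (p(l := u)) v}) ` (V - {r})" .
    have "rooted V E r (p(l := u)) (d(l := Suc (d u)))"
      using pd fin less.prems(2) uV by (subst rooted_def) (auto simp: E rooted_def)
    then show ?thesis by blast
  qed
qed

text \<open>The choice of a deepest vertex needs levels: parent and child must differ by exactly
  one, which the rank of \<open>rooted\<close> does not promise.\<close>

lemma rooted_depth: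
  assumes T: "rooted V E r p d"
  shows "\<exists>h :: 'a \<Rightarrow> nat. h r = 0 \<and> (\<forall>v\<in>V - {r}. h v = Suc (h (p v)))"
proof -
  have ex: "\<exists>n. (p ^^ n) v = r" if "v \<in> V" for v
    using that
  proof (induction "d v" arbitrary: v rule: less_induct)
    case less
    show ?case
    proof (cases "v = r")
      case False
      then obtain n where "(p ^^ n) (p v) = r"
        using less rooted_parent[OF T less.prems] by blast
      then have "(p ^^ Suc n) v = r" by (simp add: funpow_swap1)
      then show ?thesis by blast
    qed (auto intro: exI[of _ 0])
  qed
  define h where "h v = (LEAST n. (p ^^ n) v = r)" for v
  have "h r = 0" by (simp add: h_def Least_eq_0)
  moreover have "h v = Suc (h (p v))" if v: "v \<in> V - {r}" for v
  proof -
    obtain n where "(p ^^ n) v = r" using ex v by blast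
    then have "h v = Suc (LEAST m. (p ^^ Suc m) v = r)"
      unfolding h_def by (rule Least_Suc) (use v in auto)
    then show ?thesis by (simp add: h_def funpow_swap1)
  qed
  ultimately show ?thesis by blast
qed

section \<open>Deleting a set of vertices together with the edges that meet it\<close>

definition del :: "'a set set \<Rightarrow> 'a set \<Rightarrow> 'a set set" where
  "del E W = {e \<in> E. e \<inter> W = {}}"

lemma nbrs_del: "nbrs (del E W) x = (if x \<in> W then {} else nbrs E x - W)"
  by (auto simp: nbrs_def del_def)

lemma simple_graph_del: "simple_graph V E \<Longrightarrow> simple_graph (V - W) (del E W)"
  by (auto simp: simple_graph_def del_def)

text \<open>The set \<open>W\<close> is closed under taking children, so every remaining vertex
  keeps its parent.\<close>

lemma rooted_del:
  assumes T: "rooted V E r p d" and "r \<notin> W"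
    and W: "\<And>u. u \<in> V \<Longrightarrow> u \<noteq> r \<Longrightarrow> p u \<in> W \<Longrightarrow> u \<in> W"
  shows "rooted (V - W) (del E W) r p d"
proof -
  have "del E W = (\<lambda>v. {v, p v}) ` (V - W - {r})"
    using T W by (auto simp: rooted_def del_def)
  then show ?thesis
    using T W \<open>r \<notin> W\<close> by (auto simp: rooted_def)
qed

text \<open>Used after a reduction to recognize the original edge set as the result of the
  operation: \<open>F\<close> lists every edge that meets \<open>W\<close>.\<close>

lemma del_Un:
  assumes "simple_graph V E" "F \<subseteq> E" "\<And>a b. a \<in> W \<Longrightarrow> b \<in> nbrs E a \<Longrightarrow> {a, b} \<in> F"
  shows "del E W \<union> F = E"
proof
  show "del E W \<union> F \<subseteq> E" using assms(2) by (auto simp: del_def)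
  show "E \<subseteq> del E W \<union> F"
  proof
    fix e assume e: "e \<in> E"
    from edge_cases[OF assms(1) e] obtain a b where ab: "e = {a, b}" "b \<in> nbrs E a" by metis
    show "e \<in> del E W \<union> F"
    proof (cases "e \<inter> W = {}")
      case False
      then have "a \<in> W \<or> b \<in> W" using ab by auto
      then have "e \<in> F"
        using assms(3)[of a b] assms(3)[of b a] ab nbrs_sym[of b E a] by (auto simp: insert_commute)
      then show ?thesis by simp
    qed (simp add: del_def e)
  qed
qed

subsection \<open>Attaching and deleting branches\<close>

text \<open>A part \<open>W\<close> that is joined to the rest by the single edge between
  \<open>a\<close> and \<open>v\<close>.\<close>

definition branch :: "'a set \<Rightarrow> 'a set set \<Rightarrow> 'a set \<Rightarrow> 'a \<Rightarrow> 'a \<Rightarrow> bool" where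
  "branch V E W a v \<longleftrightarrow> simple_graph V E \<and> W \<subseteq> V \<and> v \<in> V - W \<and> a \<in> W \<and>
     nbrs E v \<inter> W = {a} \<and> (\<forall>x\<in>W. nbrs E x \<subseteq> insert v W)"

lemma branch_nbrs:
  assumes "branch V E W a v" "x \<in> V - W" "x \<noteq> v"
  shows "nbrs (del E W) x = nbrs E x"
proof -
  have "y \<notin> W" if "y \<in> nbrs E x" for y
    using that assms nbrs_sym[of y E x] by (auto simp: branch_def)
  then show ?thesis using assms(2) by (auto simp: nbrs_del)
qed

lemma branch_deg:
  assumes "branch V E W a v"
  shows "deg E v = Suc (deg (del E W) v)"
proof -
  have "nbrs E v - W = nbrs E v - {a}" "a \<in> nbrs E v" "v \<notin> W" "finite (nbrs E v)"
    using assms finite_nbrs[of V E v] by (auto simp: branch_def)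
  then show ?thesis using card.remove[of "nbrs E v" a] by (simp add: deg_def nbrs_del del: card_Diff_insert card_Diff_singleton)
qed

text \<open>Only \<open>v\<close> loses a neighbor, and with two neighbors left it does not become a
  leaf.\<close>

lemma branch_inner:
  assumes "branch V E W a v" "deg (del E W) v \<ge> 2"
  shows "leaves (V - W) (del E W) = leaves V E - W"
    and "inner (V - W) (del E W) = inner V E - W"
proof -
  have "x \<in> leaves (V - W) (del E W) \<longleftrightarrow> x \<in> leaves V E - W" for x
  proof (cases "x = v")
    case True
    then show ?thesis using assms(2) branch_deg[OF assms(1)] by (auto simp: leaves_def)
  next
    case False
    then show ?thesis using branch_nbrs[OF assms(1) _ False] by (auto simp: leaves_def deg_def)
  qed
  then show "leaves (V - W) (del E W) = leaves V E - W" by blast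
  then show "inner (V - W) (del E W) = inner V E - W" by (auto simp: inner_def)
qed

text \<open>No arrow crosses between \<open>W\<close> and the rest, so injectivity and the absence
  of 2-cycles hold on each side separately. Only a source in \<open>W\<close> may look for its
  source neighbor on the other side.\<close>

lemma forcing_map_attach:
  assumes f: "forcing_map (V - W) (del E W) f" and W: "W \<subseteq> V" "simple_graph V E"
    and inn: "inner V E - W = inner (V - W) (del E W)"
    and A: "A = inner V E \<inter> W"
    and g: "inj_on g A" "\<And>x. x \<in> A \<Longrightarrow> g x \<in> W \<inter> nbrs E x"
      "\<And>x. x \<in> A \<Longrightarrow> g x \<in> A \<Longrightarrow> g (g x) \<noteq> x"
    and src: "\<And>s. s \<in> W - g ` A \<Longrightarrow>
      \<exists>t\<in>W - g ` A \<union> sources (V - W) (del E W) f. t \<in> nbrs E s"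
  shows "forcing_map V E (\<lambda>x. if x \<in> W then g x else f x)" (is "forcing_map V E ?h")
proof -
  let ?I = "inner (V - W) (del E W)"
  have eq: "inner V E = ?I \<union> A" using inn A by auto
  have I: "?I \<subseteq> V - W" by (rule inner_subset)
  have AW: "A \<subseteq> W" using A by auto
  have fI: "f x \<in> V - W" "f x \<in> nbrs E x" if "x \<in> ?I" for x
    using forcing_mapD(2)[OF f that] nbrsD(1)[OF W(2), of "f x" x]
    by (auto simp: nbrs_del split: if_splits)
  have hI: "?h x = f x" if "x \<in> ?I" for x using I that by auto
  have hA: "?h x = g x" if "x \<in> A" for x using AW that by auto
  have imI: "?h ` ?I = f ` ?I" using hI by (rule image_cong[OF refl])
  have imA: "?h ` A = g ` A" using hA by (rule image_cong[OF refl])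
  have S: "sources V E ?h = sources (V - W) (del E W) f \<union> (W - g ` A)"
    unfolding sources_def eq image_Un imI imA using fI(1) g(2) W(1) by auto
  show ?thesis
  proof (rule forcing_mapI)
    have "inj_on ?h ?I" using forcing_mapD(1)[OF f] hI inj_on_cong[of ?I ?h f] by blast
    moreover have "inj_on ?h A" using g(1) hA inj_on_cong[of A ?h g] by blast
    moreover have "f ` ?I \<subseteq> - W" "g ` A \<subseteq> W" using fI(1) g(2) by blast+
    then have "?h ` ?I \<inter> ?h ` A = {}" unfolding imI imA by blast
    ultimately show "inj_on ?h (inner V E)"
      unfolding eq inj_on_Un by blast
    show "?h x \<in> nbrs E x" if "x \<in> inner V E" for x
      using that fI g(2) hI hA unfolding eq by (metis IntE UnE)
    show "?h (?h x) \<noteq> x" if "x \<in> inner V E" "?h x \<in> inner V E" for x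
      using that(1) unfolding eq
    proof
      assume x: "x \<in> ?I"
      then have "f x \<in> ?I" using that(2) hI[OF x] fI(1)[OF x] AW unfolding eq by auto
      moreover from this x have "x \<notin> W" "f x \<notin> W" using I by auto
      ultimately show ?thesis using forcing_mapD(3)[OF f x] by simp
    next
      assume x: "x \<in> A"
      then have "g x \<in> A" using that(2) hA[OF x] g(2)[OF x] I unfolding eq by auto
      moreover from this x have "x \<in> W" "g x \<in> W" using AW by auto
      ultimately show ?thesis using g(3)[OF x] by simp
    qed
    show "\<exists>t\<in>sources V E ?h. t \<in> nbrs E s" if "s \<in> sources V E ?h" for s
      using that unfolding S
    proof
      assume "s \<in> sources (V - W) (del E W) f"
      from forcing_mapD(4)[OF f this]
      show "\<exists>t\<in>sources (V - W) (del E W) f \<union> (W - g ` A). t \<in> nbrs E s"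
        by (auto simp: nbrs_del split: if_splits)
    next
      assume "s \<in> W - g ` A"
      from src[OF this]
      show "\<exists>t\<in>sources (V - W) (del E W) f \<union> (W - g ` A). t \<in> nbrs E s" by blast
    qed
  qed
qed

text \<open>The hypotheses exclude exactly the dangers of a deletion: new leaves, arrows of
  \<open>f\<close> across the cut, and sources whose source neighbors all disappear.\<close>

lemma forcing_map_del:
  assumes f: "forcing_map V E f" and inn: "inner (V - W) (del E W) = inner V E - W"
    and fW: "\<And>x. x \<in> inner V E \<Longrightarrow> f x \<in> W \<longleftrightarrow> x \<in> W"
    and src: "\<And>s. s \<in> sources V E f - W \<Longrightarrow> \<exists>t\<in>sources V E f - W. t \<in> nbrs E s"
  shows "forcing_map (V - W) (del E W) f"
proof (rule forcing_mapI, unfold inn)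
  have S: "sources (V - W) (del E W) f = sources V E f - W"
    using fW by (auto simp: sources_def inn)
  show "inj_on f (inner V E - W)" using forcing_mapD(1)[OF f] by (rule inj_on_diff)
  show "f x \<in> nbrs (del E W) x" if "x \<in> inner V E - W" for x
    using that forcing_mapD(2)[OF f] fW by (simp add: nbrs_del)
  show "f (f x) \<noteq> x" if "x \<in> inner V E - W" "f x \<in> inner V E - W" for x
    using that forcing_mapD(3)[OF f] by simp
  show "\<exists>t\<in>sources (V - W) (del E W) f. t \<in> nbrs (del E W) s"
    if "s \<in> sources (V - W) (del E W) f" for s
    using src[of s] that unfolding S by (auto simp: nbrs_del)
qed

section \<open>Leaves as sources, and exchanging two leaves\<close>

lemma inner_if_two_nbrs:
  assumes "v \<in> V" "a \<in> nbrs E v" "b \<in> nbrs E v" "a \<noteq> b"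
  shows "v \<in> inner V E"
  using assms by (auto simp: inner_def leaves_iff)

text \<open>Only \<open>v\<close> could force the leaf \<open>l\<close>. If it does not,
  \<open>l\<close> is a source, and \<open>v\<close> is the only candidate for its source
  neighbor.\<close>

lemma leaf_source:
  assumes f: "forcing_map V E f" and l: "l \<in> leaves V E" "v \<in> nbrs E l"
    and "v \<in> inner V E \<Longrightarrow> f v \<noteq> l"
  shows "l \<in> sources V E f" "v \<in> sources V E f"
proof -
  have eq: "nbrs E l = {v}" using leaf_nbrs[OF l] .
  have "f x \<noteq> l" if "x \<in> inner V E" for x
    using assms(4) that forcing_mapD(2)[OF f that] eq nbrs_sym[of l E x] by auto
  then show "l \<in> sources V E f" using l(1) by (auto simp: sources_def leaves_def)
  from forcing_mapD(4)[OF f this] show "v \<in> sources V E f" using eq by auto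
qed

text \<open>At most one of the two leaves is forced by \<open>v\<close>; the other one makes
  \<open>v\<close> a source.\<close>

lemma two_leaves_source:
  assumes f: "forcing_map V E f" and l: "l \<in> leaves V E" "v \<in> nbrs E l"
    and l': "l' \<in> leaves V E" "v \<in> nbrs E l'" "l \<noteq> l'"
  shows "v \<in> sources V E f"
proof (cases "f v = l")
  case True
  then show ?thesis using leaf_source(2)[OF f l'(1,2)] l'(3) by blast
next
  case False
  then show ?thesis using leaf_source(2)[OF f l] by blast
qed

text \<open>Two leaves at \<open>v\<close> are interchangeable: if \<open>v\<close> forces
  \<open>l\<close>, redirect it to \<open>l'\<close>. Then \<open>l\<close> becomes a source beside
  the source \<open>v\<close>, and the loss of \<open>l'\<close> as a source concerns only
  \<open>v\<close>, which has \<open>l\<close> instead. This frees a chosen leaf from being forced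
  before O3 extends it or O2 is undone at it.\<close>

lemma forcing_map_avoid_leaf:
  assumes sg: "simple_graph V E" and ex: "\<exists>f. forcing_map V E f"
    and l: "l \<in> leaves V E" "v \<in> nbrs E l"
    and l': "l' \<in> leaves V E" "v \<in> nbrs E l'" "l \<noteq> l'"
  shows "\<exists>f. forcing_map V E f \<and> f v \<noteq> l"
proof -
  obtain f where f: "forcing_map V E f" using ex by blast
  show ?thesis
  proof (cases "f v = l")
    case True
    let ?I = "inner V E"
    have n: "l \<in> nbrs E v" "l' \<in> nbrs E v" using l l' by (simp_all add: nbrs_sym[of _ E v])
    have v: "v \<in> ?I" using nbrsD(1)[OF sg l(2)] n l'(3) by (rule inner_if_two_nbrs)
    have vS: "v \<in> sources V E f" by (rule two_leaves_source[OF f l l'])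
    have l'S: "l' \<in> sources V E f" using leaf_source(1)[OF f l'(1,2)] True l'(3) by blast
    have nl: "l \<notin> ?I" "l' \<notin> ?I" using l l' by (auto simp: inner_def)
    have nl': "nbrs E l' = {v}" using leaf_nbrs[OF l'(1,2)] .
    define h where "h = f(v := l')"
    have hv: "h v = l'" and hx: "\<And>x. x \<noteq> v \<Longrightarrow> h x = f x" by (auto simp: h_def)
    have im: "h ` ?I = insert l' (f ` (?I - {v}))" using v by (auto simp: h_def)
    have fim: "f ` (?I - {v}) = f ` ?I - {l}"
      using inj_on_image_set_diff[OF forcing_mapD(1)[OF f], of ?I "{v}"] v True by auto
    have S: "sources V E h = insert l (sources V E f - {l'})"
      unfolding sources_def im fim using l(1) l'(3) by (auto simp: leaves_def)
    have "forcing_map V E h"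
    proof (rule forcing_mapI)
      have "inj_on f (?I - {v})" using forcing_mapD(1)[OF f] by (rule inj_on_diff)
      then have "inj_on h (?I - {v})" using hx inj_on_cong[of "?I - {v}" h f] by blast
      moreover have "h v \<notin> h ` (?I - {v})"
        using l'S hv by (auto simp: sources_def h_def)
      ultimately have "inj_on h (insert v (?I - {v}))" by (subst inj_on_insert) simp
      then show "inj_on h ?I" using v by (simp add: insert_absorb)
      show "h x \<in> nbrs E x" if "x \<in> ?I" for x
        using forcing_mapD(2)[OF f that] n hv hx by metis
      show "h (h x) \<noteq> x" if x: "x \<in> ?I" "h x \<in> ?I" for x
      proof (cases "x = v")
        case True
        then show ?thesis using x(2) nl hv by simp
      next
        case False
        then have "f x \<in> ?I" "h x = f x" using x hx by auto
        moreover have "f x \<noteq> v" using vS x(1) by (auto simp: sources_def)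
        ultimately show ?thesis using forcing_mapD(3)[OF f x(1)] hx by simp
      qed
      show "\<exists>t\<in>sources V E h. t \<in> nbrs E s" if s: "s \<in> sources V E h" for s
      proof (cases "s = v")
        case True
        then show ?thesis using S n by blast
      next
        case False
        show ?thesis
        proof (cases "s = l")
          case True
          have "v \<noteq> l'" using v nl(2) by blast
          then show ?thesis using True S vS l(2) by blast
        next
          case False
          then obtain t where t: "t \<in> sources V E f" "t \<in> nbrs E s"
            using s forcing_mapD(4)[OF f, of s] by (auto simp: S)
          then have "t \<noteq> l'" using nl' \<open>s \<noteq> v\<close> nbrs_sym[of t E s] by auto
          then show ?thesis using t S by blast
        qed
      qed
    qed
    moreover have "h v \<noteq> l" using hv l'(3) by simp
    ultimately show ?thesis by blast
  qed (use f in blast)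
qed

lemma strong_support_iff:
  assumes "simple_graph V E"
  shows "strong_support V E v \<longleftrightarrow> (\<exists>l l'. l \<noteq> l' \<and> l \<in> leaves V E \<and> l' \<in> leaves V E \<and>
    v \<in> nbrs E l \<and> v \<in> nbrs E l')"
proof
  assume "strong_support V E v"
  then have c: "card (nbrs E v \<inter> leaves V E) \<ge> 2" by (simp add: strong_support_def)
  then obtain l where l: "l \<in> nbrs E v \<inter> leaves V E"
    using card_ge_2_other[OF c, of undefined] by blast
  obtain l' where "l' \<in> nbrs E v \<inter> leaves V E" "l' \<noteq> l"
    using card_ge_2_other[OF c, of l] by blast
  with l show "\<exists>l l'. l \<noteq> l' \<and> l \<in> leaves V E \<and> l' \<in> leaves V E \<and>
    v \<in> nbrs E l \<and> v \<in> nbrs E l'" by (auto simp: nbrs_sym[of v])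
next
  assume "\<exists>l l'. l \<noteq> l' \<and> l \<in> leaves V E \<and> l' \<in> leaves V E \<and> v \<in> nbrs E l \<and> v \<in> nbrs E l'"
  then obtain l l' where l: "l \<noteq> l'" "l \<in> leaves V E" "l' \<in> leaves V E"
    "v \<in> nbrs E l" "v \<in> nbrs E l'" by blast
  then have "{l, l'} \<subseteq> nbrs E v \<inter> leaves V E" by (auto simp: nbrs_sym[of _ E v])
  then have "card {l, l'} \<le> card (nbrs E v \<inter> leaves V E)"
    using finite_nbrs[OF assms] by (intro card_mono) auto
  then show "strong_support V E v"
    using l nbrsD(1)[OF assms l(4)] by (simp add: strong_support_def)
qed

subsection \<open>The family \<open>\<F>\<close> admits forcing maps\<close>

lemma del_fresh:
  assumes "simple_graph V E" "W \<inter> V = {}" "\<And>e. e \<in> F \<Longrightarrow> e \<inter> W \<noteq> {}"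
  shows "del (E \<union> F) W = E"
  using assms by (fastforce simp: del_def simple_graph_def)

lemma simple_graph_Un:
  assumes "simple_graph V E" "finite W" "\<And>e. e \<in> F \<Longrightarrow> e \<subseteq> V \<union> W \<and> card e = 2"
  shows "simple_graph (V \<union> W) (E \<union> F)"
  using assms by (auto simp: simple_graph_def)

lemma branch_Un:
  assumes sg: "simple_graph V E" and W: "finite W" "W \<inter> V = {}"
    and F: "\<forall>e\<in>F. e \<inter> W \<noteq> {} \<and> e \<subseteq> insert v W \<and> card e = 2"
    and v: "v \<in> V" "a \<in> W" "nbrs F v = {a}"
  shows "branch (V \<union> W) (E \<union> F) W a v" "del (E \<union> F) W = E" "V \<union> W - W = V"
proof -
  have Fv: "e \<subseteq> V \<union> W \<and> card e = 2" if "e \<in> F" for e using F that v(1) by blast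
  have E: "nbrs E x = {}" if "x \<in> W" for x using nbrs_outside[OF sg] that W(2) by blast
  have "nbrs F x \<subseteq> insert v W" for x
    using F by (auto simp: nbrs_def)
  moreover have "nbrs E v \<inter> W = {}" using nbrsD(1)[OF sg] W(2) by blast
  ultimately show "branch (V \<union> W) (E \<union> F) W a v"
    using simple_graph_Un[OF sg W(1) Fv] v E W(2) unfolding branch_def nbrs_Un by auto
  show "del (E \<union> F) W = E" using del_fresh[OF sg W(2)] F by blast
  show "V \<union> W - W = V" using W(2) by auto
qed

text \<open>The common frame of O2, O4 and O5. All conditions speak of the new edges
  \<open>F\<close> alone, since the new vertices have no other edges; \<open>A\<close> consists of
  those new vertices that are not leaves.\<close>

lemma forcing_map_branch_Un:
  assumes sg: "simple_graph V E" and W: "finite W" "W \<inter> V = {}"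
    and F: "\<forall>e\<in>F. e \<inter> W \<noteq> {} \<and> e \<subseteq> insert v W \<and> card e = 2"
    and v: "v \<in> V" "a \<in> W" "nbrs F v = {a}" "deg E v \<ge> 2"
    and f: "forcing_map V E f"
    and A: "A \<subseteq> W" "\<And>x. x \<in> W \<Longrightarrow> x \<in> A \<longleftrightarrow> (\<forall>u. nbrs F x \<noteq> {u})"
    and g: "inj_on g A" "\<And>x. x \<in> A \<Longrightarrow> g x \<in> W \<inter> nbrs F x"
      "\<And>x. x \<in> A \<Longrightarrow> g x \<in> A \<Longrightarrow> g (g x) \<noteq> x"
    and src: "\<And>s. s \<in> W - g ` A \<Longrightarrow> \<exists>t\<in>W - g ` A \<union> sources V E f. t \<in> nbrs F s"
  shows "\<exists>f. forcing_map (V \<union> W) (E \<union> F) f"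
proof -
  note B = branch_Un[OF sg W F v(1-3)]
  have sg': "simple_graph (V \<union> W) (E \<union> F)" using B(1) by (simp add: branch_def)
  have n: "nbrs (E \<union> F) x = nbrs F x" if "x \<in> W" for x
    using that nbrs_outside[OF sg, of x] W(2) by (auto simp: nbrs_Un)
  have "inner (V \<union> W) (E \<union> F) - W = inner V E"
    using branch_inner(2)[OF B(1), unfolded B(2,3)] v(4) by simp
  moreover have "A = inner (V \<union> W) (E \<union> F) \<inter> W"
    using A n by (auto simp: inner_def leaves_iff)
  moreover have "nbrs F x \<subseteq> nbrs (E \<union> F) x" for x by (simp add: nbrs_Un)
  ultimately show ?thesis
    using forcing_map_attach[of "V \<union> W" W "E \<union> F" f A g, unfolded B(2,3), OF f _ sg' _ _ g(1) _ g(3)]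
      g(2) src by blast
qed

lemma deg_ge_2I:
  assumes "simple_graph V E" "a \<in> nbrs E v" "b \<in> nbrs E v" "a \<noteq> b"
  shows "deg E v \<ge> 2"
proof -
  have "card {a, b} \<le> card (nbrs E v)"
    using assms(2,3) finite_nbrs[OF assms(1)] by (intro card_mono) auto
  then show ?thesis using assms(4) by (simp add: deg_def)
qed

lemma strong_support_deg:
  assumes "simple_graph V E" "strong_support V E v"
  shows "deg E v \<ge> 2"
  using assms deg_ge_2I[OF assms(1)] nbrs_sym[of v E] unfolding strong_support_iff[OF assms(1)]
  by blast

text \<open>A strong support vertex is a source, so the new leaf, which nobody forces, has a source
  neighbor.\<close>

lemma forcing_map_O2:
  assumes sg: "simple_graph V E" and f: "forcing_map V E f"
    and v: "strong_support V E v" and w: "w \<notin> V"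
  shows "\<exists>f. forcing_map (insert w V) (insert {v, w} E) f"
proof -
  have vV: "v \<in> V" using v by (simp add: strong_support_def)
  have vS: "v \<in> sources V E f"
    using v two_leaves_source[OF f] unfolding strong_support_iff[OF sg] by blast
  have "\<exists>f. forcing_map (V \<union> {w}) (E \<union> {{v, w}}) f"
    using vV w vS
    by (intro forcing_map_branch_Un[OF sg _ _ _ _ _ _ strong_support_deg[OF sg v] f,
          of "{w}" "{{v, w}}" w "{}" id])
      (auto simp: nbrs_insert card_insert_if)
  then show ?thesis by simp
qed

text \<open>Here the attaching vertex \<open>v\<close> stops being a leaf, so \<open>f\<close>
  itself must be extended. After freeing \<open>v\<close> from being forced by \<open>w\<close>,
  both are sources; then \<open>v\<close> may force \<open>y\<close>, and \<open>x\<close> becomes a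
  source beside \<open>v\<close>.\<close>

lemma forcing_map_O3:
  assumes sg: "simple_graph V E" and ex: "\<exists>f. forcing_map V E f"
    and w: "strong_support V E w" and v: "v \<in> nbrs E w \<inter> leaves V E"
    and xy: "distinct [x, y]" "{x, y} \<inter> V = {}"
  shows "\<exists>f. forcing_map (V \<union> {x, y}) (E \<union> {{v, x}, {v, y}}) f"
proof -
  let ?V = "V \<union> {x, y}" and ?E = "E \<union> {{v, x}, {v, y}}"
  have vl: "v \<in> leaves V E" and wv: "w \<in> nbrs E v" using v nbrs_sym[of v E w] by auto
  obtain l where l: "l \<in> leaves V E" "w \<in> nbrs E l" "v \<noteq> l"
    using w unfolding strong_support_iff[OF sg] by metis
  obtain f where f: "forcing_map V E f" "f w \<noteq> v"
    using forcing_map_avoid_leaf[OF sg ex vl wv l] by blast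
  have S: "v \<in> sources V E f" "w \<in> sources V E f"
    using leaf_source[OF f(1) vl wv] f(2) by blast+
  have vV: "v \<in> V" using vl by (simp add: leaves_def)
  have nv: "nbrs E v = {w}" using leaf_nbrs[OF vl wv] .
  have nV: "nbrs ?E z = nbrs E z" if "z \<in> V" "z \<noteq> v" for z
    using that xy(2) by (auto simp: nbrs_Un nbrs_insert)
  have nn: "nbrs ?E v = {w, x, y}" "nbrs ?E x = {v}" "nbrs ?E y = {v}"
    using xy nv vV nbrs_outside[OF sg, of x] nbrs_outside[OF sg, of y]
    by (auto simp: nbrs_Un nbrs_insert)
  have sub: "nbrs E z \<subseteq> nbrs ?E z" for z unfolding nbrs_Un by blast
  have "z \<in> inner ?V ?E \<longleftrightarrow> z \<in> insert v (inner V E)" for z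
  proof (cases "z \<in> V \<and> z \<noteq> v")
    case True
    then show ?thesis using nV by (auto simp: inner_def leaves_iff)
  next
    case False
    have "\<nexists>u. {w, x, y} = {u}" using xy(1) by auto
    then show ?thesis using False nn xy vV inner_subset[of V E] by (auto simp: inner_def leaves_iff)
  qed
  then have I: "inner ?V ?E = insert v (inner V E)" by blast
  have vI: "v \<notin> inner V E" using vl by (simp add: inner_def)
  define h where "h = f(v := y)"
  have hv: "h v = y" and hx: "\<And>z. z \<noteq> v \<Longrightarrow> h z = f z" by (auto simp: h_def)
  have im: "h ` inner V E = f ` inner V E" using vI hx by (metis image_cong)
  have fV: "f z \<in> V" if "z \<in> inner V E" for z
    using nbrsD(1)[OF sg forcing_mapD(2)[OF f(1) that]] .
  have S': "sources ?V ?E h = insert x (sources V E f)"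
    unfolding sources_def I image_insert im hv using fV xy by auto
  have "forcing_map ?V ?E h"
  proof (rule forcing_mapI)
    have "inj_on h (inner V E)"
      using forcing_mapD(1)[OF f(1)] hx vI inj_on_cong[of "inner V E" h f] by metis
    moreover have "h v \<notin> h ` inner V E" unfolding im hv using fV xy by auto
    ultimately show "inj_on h (inner ?V ?E)" unfolding I using vI by (subst inj_on_insert) simp
    show "h z \<in> nbrs ?E z" if "z \<in> inner ?V ?E" for z
      using that forcing_mapD(2)[OF f(1)] hv hx nn sub[of z] unfolding I by (cases "z = v") auto
    show "h (h z) \<noteq> z" if z: "z \<in> inner ?V ?E" "h z \<in> inner ?V ?E" for z
    proof (cases "z = v")
      case True
      then show ?thesis using z(2) hv xy vV inner_subset[of V E] unfolding I by auto
    next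
      case False
      then have zi: "z \<in> inner V E" "h z = f z" using z(1) hx unfolding I by auto
      then have "f z \<noteq> v" using S(1) by (auto simp: sources_def)
      then show ?thesis using forcing_mapD(3)[OF f(1) zi(1)] zi z(2) hx unfolding I by auto
    qed
    show "\<exists>t\<in>sources ?V ?E h. t \<in> nbrs ?E s" if "s \<in> sources ?V ?E h" for s
      using that forcing_mapD(4)[OF f(1), of s] S sub[of s] nn unfolding S' by blast
  qed
  then show ?thesis by blast
qed

text \<open>The center \<open>y\<close> forces \<open>z\<close>; the new sources \<open>x\<close>
  and \<open>y\<close> serve each other.\<close>

lemma forcing_map_O4:
  assumes sg: "simple_graph V E" and f: "forcing_map V E f"
    and v: "v \<in> V" "deg E v \<ge> 2" and xyz: "distinct [x, y, z]" "{x, y, z} \<inter> V = {}"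
  shows "\<exists>f. forcing_map (V \<union> {x, y, z}) (E \<union> {{x, y}, {y, z}, {v, y}}) f"
proof (rule forcing_map_branch_Un[OF sg _ _ _ v(1) _ _ v(2) f,
      where A = "{y}" and g = "\<lambda>_. z" and a = y])
  let ?F = "{{x, y}, {y, z}, {v, y}}"
  have v': "v \<noteq> x" "v \<noteq> y" "v \<noteq> z" using v xyz by auto
  show "nbrs ?F v = {y}" using xyz v' by (auto simp: nbrs_insert)
  have n: "nbrs ?F x = {y}" "nbrs ?F y = {x, z, v}" "nbrs ?F z = {y}"
    using xyz v' by (auto simp: nbrs_insert)
  have "{x, z, v} \<noteq> {u}" for u using xyz by auto
  then show "s \<in> {y} \<longleftrightarrow> (\<forall>u. nbrs ?F s \<noteq> {u})" if "s \<in> {x, y, z}" for s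
    using that n xyz by auto
  show "\<exists>t\<in>{x, y, z} - (\<lambda>_. z) ` {y} \<union> sources V E f. t \<in> nbrs ?F s"
    if "s \<in> {x, y, z} - (\<lambda>_. z) ` {y}" for s
    using that n xyz by auto
  show "\<forall>e\<in>?F. e \<inter> {x, y, z} \<noteq> {} \<and> e \<subseteq> insert v {x, y, z} \<and> card e = 2"
    using xyz v' by auto
  show "(\<lambda>_. z) s \<in> {x, y, z} \<inter> nbrs ?F s" if "s \<in> {y}" for s
    using that n by simp
qed (use xyz in auto)

lemma forcing_map_O5:
  assumes sg: "simple_graph V E" and f: "forcing_map V E f"
    and v: "v \<in> V" "deg E v \<ge> 2" and W: "distinct [u1, v1, v2, v3, v4, u3]"
      "{u1, v1, v2, v3, v4, u3} \<inter> V = {}"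
  shows "\<exists>f. forcing_map (V \<union> {u1, v1, v2, v3, v4, u3})
    (E \<union> {{u1, v1}, {v1, v2}, {v2, v3}, {v3, v4}, {v3, u3}, {v, v1}}) f"
proof -
  let ?W = "{u1, v1, v2, v3, v4, u3}"
  let ?F = "{{u1, v1}, {v1, v2}, {v2, v3}, {v3, v4}, {v3, u3}, {v, v1}}"
  \<comment> \<open>The forcing chain runs \<open>v3\<close> to \<open>v2\<close> to
    \<open>v1\<close> to \<open>u1\<close>, the last arrow coming from the constant function. The
    new sources are \<open>v3\<close>, \<open>v4\<close> and \<open>u3\<close>, which form a
    star.\<close>
  let ?g = "(\<lambda>_. u1)(v3 := v2, v2 := v1)"
  have v': "v \<noteq> u1" "v \<noteq> v1" "v \<noteq> v2" "v \<noteq> v3" "v \<noteq> v4" "v \<noteq> u3" using v W by auto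
  have d: "u1 \<noteq> v1" "u1 \<noteq> v2" "u1 \<noteq> v3" "u1 \<noteq> v4" "u1 \<noteq> u3" "v1 \<noteq> v2" "v1 \<noteq> v3" "v1 \<noteq> v4"
    "v1 \<noteq> u3" "v2 \<noteq> v3" "v2 \<noteq> v4" "v2 \<noteq> u3" "v3 \<noteq> v4" "v3 \<noteq> u3" "v4 \<noteq> u3"
    using W(1) by auto
  note d' = d d[symmetric] v' v'[symmetric]
  have nv: "nbrs ?F v = {v1}" using d' by (simp add: nbrs_insert)
  have n: "nbrs ?F u1 = {v1}" "nbrs ?F v1 = {u1, v2, v}" "nbrs ?F v2 = {v1, v3}"
    "nbrs ?F v3 = {v2, v4, u3}" "nbrs ?F v4 = {v3}" "nbrs ?F u3 = {v3}"
    using d' by (auto simp: nbrs_insert)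
  have two: "{u1, v2, v} \<noteq> {u}" "{v1, v3} \<noteq> {u}" "{v2, v4, u3} \<noteq> {u}" for u
    using d by auto
  have im: "?g ` {v1, v2, v3} = {u1, v1, v2}" using d' by auto
  show ?thesis
  proof (rule forcing_map_branch_Un[OF sg _ W(2) _ v(1) _ nv v(2) f,
        where A = "{v1, v2, v3}" and g = ?g], unfold im)
    show "s \<in> {v1, v2, v3} \<longleftrightarrow> (\<forall>u. nbrs ?F s \<noteq> {u})" if "s \<in> ?W" for s
      using that by (elim insertE emptyE) (simp_all add: n two d')
    show "\<exists>t\<in>?W - {u1, v1, v2} \<union> sources V E f. t \<in> nbrs ?F s" if "s \<in> ?W - {u1, v1, v2}" for s
    proof -
      have "s = v3 \<or> s = v4 \<or> s = u3" using that by auto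
      then show ?thesis
      proof (elim disjE)
        assume "s = v3" then show ?thesis using n d' by (intro bexI[of _ v4]) auto
      next
        assume "s = v4" then show ?thesis using n d' by (intro bexI[of _ v3]) auto
      next
        assume "s = u3" then show ?thesis using n d' by (intro bexI[of _ v3]) auto
      qed
    qed
    show "\<forall>e\<in>?F. e \<inter> ?W \<noteq> {} \<and> e \<subseteq> insert v ?W \<and> card e = 2"
      by (simp add: d')
    show "?g s \<in> ?W \<inter> nbrs ?F s" if "s \<in> {v1, v2, v3}" for s
      using that by (elim insertE emptyE) (simp_all add: n d')
    show "inj_on ?g {v1, v2, v3}" using d' by (simp add: inj_on_def)
    show "?g (?g s) \<noteq> s" if "s \<in> {v1, v2, v3}" "?g s \<in> {v1, v2, v3}" for s
      using that by (elim insertE emptyE) (simp_all add: d')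
  qed auto
qed

subsection \<open>Subdividing an edge\<close>

definition subdiv :: "'a set set \<Rightarrow> 'a \<Rightarrow> 'a \<Rightarrow> 'a \<Rightarrow> 'a set set" where
  "subdiv E u v w = (E - {{u, v}}) \<union> {{u, w}, {w, v}}"

lemma subdiv_commute: "subdiv E u v w = subdiv E v u w"
  by (auto simp: subdiv_def insert_commute)

lemma nbrs_subdiv:
  assumes sg: "simple_graph V E" and e: "{u, v} \<in> E" and w: "w \<notin> V"
  shows "nbrs (subdiv E u v w) x =
    (if x = w then {u, v} else if x = u then insert w (nbrs E u - {v})
     else if x = v then insert w (nbrs E v - {u}) else nbrs E x)"
proof -
  have uv: "u \<in> V" "v \<in> V" "u \<noteq> v" using nbrsD[OF sg, of v u] e by (auto simp: nbrs_def)
  then have ne: "w \<noteq> u" "w \<noteq> v" using w by auto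
  have D: "nbrs (E - {{u, v}}) x = nbrs E x - (if x = u then {v} else if x = v then {u} else {})"
    using uv by (auto simp: nbrs_def doubleton_eq_iff)
  have "nbrs E w = {}" using nbrs_outside[OF sg w] .
  then show ?thesis
    using uv ne by (auto simp: subdiv_def nbrs_Un nbrs_insert D)
qed

lemma simple_graph_subdiv:
  assumes "simple_graph V E" "{u, v} \<in> E" "w \<notin> V"
  shows "simple_graph (insert w V) (subdiv E u v w)"
proof -
  have "u \<in> V" "v \<in> V" using nbrsD[OF assms(1), of v u] assms(2) by (auto simp: nbrs_def)
  moreover from this have "u \<noteq> w" "w \<noteq> v" using assms(3) by auto
  ultimately show ?thesis using assms(1) by (auto simp: simple_graph_def subdiv_def)
qed

lemma card_exchange:
  assumes "finite A" "b \<in> A" "w \<notin> A"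
  shows "card (insert w (A - {b})) = card A"
  using card.remove[OF assms(1,2)] card_insert_disjoint[of "A - {b}" w] assms by simp

lemma deg_subdiv:
  assumes sg: "simple_graph V E" and e: "{u, v} \<in> E" and w: "w \<notin> V" and x: "x \<in> V"
  shows "deg (subdiv E u v w) x = deg E x"
proof -
  have uv: "v \<in> nbrs E u" "u \<in> nbrs E v" using e by (auto simp: nbrs_def insert_commute)
  have fin: "finite (nbrs E x)" for x by (rule finite_nbrs[OF sg])
  have "w \<notin> nbrs E x" for x using nbrsD(1)[OF sg] w by blast
  then have "card (insert w (nbrs E u - {v})) = card (nbrs E u)"
    "card (insert w (nbrs E v - {u})) = card (nbrs E v)"
    using card_exchange fin uv by metis+
  then show ?thesis
    using w x unfolding deg_def nbrs_subdiv[OF sg e w] by auto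
qed

lemma inner_subdiv:
  assumes sg: "simple_graph V E" and e: "{u, v} \<in> E" and w: "w \<notin> V"
  shows "inner (insert w V) (subdiv E u v w) = insert w (inner V E)"
proof -
  have "u \<noteq> v" using nbrsD(3)[OF sg, of v u] e by (auto simp: nbrs_def)
  then have "deg (subdiv E u v w) w = 2" by (simp add: deg_def nbrs_subdiv[OF sg e w])
  then show ?thesis
    using deg_subdiv[OF sg e w] w by (auto simp: inner_def leaves_def)
qed

lemma inj_on_insertI: "inj_on f A \<Longrightarrow> f a \<notin> f ` A \<Longrightarrow> inj_on f (insert a A)"
  by (subst inj_on_insert) blast

text \<open>The arrow from \<open>u\<close> to \<open>v\<close> is itself subdivided:
  \<open>u\<close> forces \<open>w\<close> and \<open>w\<close> forces \<open>v\<close>. The sources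
  stay the same.\<close>

lemma forcing_map_subdiv_forcing_edge:
  assumes sg: "simple_graph V E" and e: "{u, v} \<in> E" and w: "w \<notin> V"
    and f: "forcing_map V E f" and u: "u \<in> inner V E" "f u = v"
  shows "\<exists>f. forcing_map (insert w V) (subdiv E u v w) f"
proof -
  let ?V = "insert w V" and ?E = "subdiv E u v w" and ?I = "inner V E"
  note n = nbrs_subdiv[OF sg e w]
  note I = inner_subdiv[OF sg e w]
  have uv: "u \<in> V" "v \<in> V" "u \<noteq> v" using nbrsD[OF sg, of v u] e by (auto simp: nbrs_def)
  then have wne: "w \<noteq> u" "w \<noteq> v" using w by auto
  have wI: "w \<notin> ?I" using w inner_subset[of V E] by auto
  define h where "h = f(u := w, w := v)"
  have h: "h u = w" "h w = v" "\<And>x. x \<noteq> u \<Longrightarrow> x \<noteq> w \<Longrightarrow> h x = f x"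
    using wne by (auto simp: h_def)
  have hf: "h x = f x" if "x \<in> ?I - {u}" for x using h(3) that wI by auto
  have "h ` (?I - {u}) = f ` (?I - {u})" using hf by (rule image_cong[OF refl])
  also have "\<dots> = f ` ?I - {v}"
    using inj_on_image_set_diff[OF forcing_mapD(1)[OF f], of ?I "{u}"] u by auto
  finally have im: "h ` (?I - {u}) = f ` ?I - {v}" .
  have fV: "f x \<in> V" if "x \<in> ?I" for x using nbrsD(1)[OF sg forcing_mapD(2)[OF f that]] .
  have Iu: "insert w ?I = insert w (insert u (?I - {u}))" using u(1) by auto
  have vf: "v \<in> f ` ?I" using u by auto
  have im': "h ` insert w ?I = insert w (f ` ?I)"
    unfolding Iu image_insert im h(1,2) using vf by auto
  have S: "sources ?V ?E h = sources V E f"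
    unfolding sources_def I im' using fV w by auto
  have "forcing_map ?V ?E h"
  proof (rule forcing_mapI)
    have "inj_on f (?I - {u})" using forcing_mapD(1)[OF f] by (rule inj_on_diff)
    then have "inj_on h (?I - {u})" using hf inj_on_cong[of "?I - {u}" h f] by blast
    moreover have "w \<notin> h ` (?I - {u})" "v \<notin> h ` (?I - {u})" unfolding im using fV w by auto
    ultimately have "inj_on h (insert w (insert u (?I - {u})))"
      using h(1,2) wne by (intro inj_on_insertI) auto
    then show "inj_on h (inner ?V ?E)" unfolding I Iu .
    show "h x \<in> nbrs ?E x" if "x \<in> inner ?V ?E" for x
    proof -
      consider "x = w" | "x = u" | "x \<noteq> w" "x \<noteq> u" "x \<in> ?I" using \<open>x \<in> inner ?V ?E\<close> I by auto
      then show ?thesis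
      proof cases
        case 3
        have "\<not> (x = v \<and> f x = u)" using forcing_mapD(3)[OF f u(1)] 3 u(2) by auto
        then show ?thesis using 3 h(3) forcing_mapD(2)[OF f 3(3)] by (auto simp: n)
      qed (use h wne in \<open>auto simp: n\<close>)
    qed
    show "h (h x) \<noteq> x" if x: "x \<in> inner ?V ?E" "h x \<in> inner ?V ?E" for x
    proof -
      consider "x = w" | "x = u" | "x \<noteq> w" "x \<noteq> u" "x \<in> ?I" using x I by auto
      then show ?thesis
      proof cases
        case 1
        then have "v \<in> ?I" using x(2) h(2) wne I by auto
        then have "h v \<in> V" using h(3)[of v] uv wne fV by auto
        then show ?thesis using 1 h(2) w by auto
      next
        case 2
        then show ?thesis using h uv by auto
      next
        case 3
        show ?thesis
        proof (cases "f x = u")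
          case True
          then show ?thesis using 3 h by auto
        next
          case False
          have "f x \<noteq> w" using fV[OF 3(3)] w by auto
          moreover have hx: "h x = f x" using 3 h(3) by blast
          ultimately have "f x \<in> ?I" "h (h x) = f (f x)"
            using False h(3)[of "f x"] x(2) I by auto
          then show ?thesis using forcing_mapD(3)[OF f 3(3)] by simp
        qed
      qed
    qed
    show "\<exists>t\<in>sources ?V ?E h. t \<in> nbrs ?E s" if s: "s \<in> sources ?V ?E h" for s
    proof -
      from s have sS: "s \<in> sources V E f" using S by simp
      obtain t where t: "t \<in> sources V E f" "t \<in> nbrs E s" using forcing_mapD(4)[OF f sS] by blast
      \<comment> \<open>As \<open>v\<close> is forced, the edge that disappears never joined two
        sources.\<close>
      have "s \<noteq> v" "t \<noteq> v" "s \<noteq> w" using sS t vf w by (auto simp: sources_def)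
      then have "t \<in> nbrs ?E s" using t(2) by (auto simp: n)
      then show ?thesis using t S by blast
    qed
  qed
  then show ?thesis by blast
qed

text \<open>The new case is that neither end forces the other. Then the degree bound makes
  \<open>u\<close> and \<open>v\<close> sources, and no other neighbor of \<open>u\<close> is one.
  Let \<open>w\<close> force \<open>u\<close>: now \<open>w\<close> takes over from \<open>u\<close>
  as the source beside \<open>v\<close>, and no other source relied on \<open>u\<close>.\<close>

lemma forcing_map_subdiv:
  assumes sg: "simple_graph V E" and e: "{u, v} \<in> E" and w: "w \<notin> V"
    and f: "forcing_map V E f" and deg: "deg E u \<le> 2"
  shows "\<exists>f. forcing_map (insert w V) (subdiv E u v w) f"
proof -
  let ?V = "insert w V" and ?E = "subdiv E u v w" and ?I = "inner V E"
  have uv: "u \<in> V" "v \<in> V" "u \<noteq> v" using nbrsD[OF sg, of v u] e by (auto simp: nbrs_def)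
  have e': "{v, u} \<in> E" using e by (simp add: insert_commute)
  then have nb: "v \<in> nbrs E u" "u \<in> nbrs E v" using e by (auto simp: nbrs_def)
  consider "u \<in> ?I" "f u = v" | "v \<in> ?I" "f v = u"
    | "u \<in> ?I \<Longrightarrow> f u \<noteq> v" "v \<in> ?I \<Longrightarrow> f v \<noteq> u" by blast
  then show ?thesis
  proof cases
    case 1
    then show ?thesis by (rule forcing_map_subdiv_forcing_edge[OF sg e w f])
  next
    case 2
    then show ?thesis
      using forcing_map_subdiv_forcing_edge[OF sg e' w f] by (simp add: subdiv_commute)
  next
    case 3
    note n = nbrs_subdiv[OF sg e w]
    note I = inner_subdiv[OF sg e w]
    have wne: "w \<noteq> u" "w \<noteq> v" using uv w by auto
    have wI: "w \<notin> ?I" using w inner_subset[of V E] by auto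
    have fV: "f x \<in> V" if "x \<in> ?I" for x using nbrsD(1)[OF sg forcing_mapD(2)[OF f that]] .
    \<comment> \<open>By the degree bound \<open>x\<close> is the only neighbor of \<open>u\<close>
      besides \<open>v\<close>, which \<open>u\<close> does not force.\<close>
    have other: "u \<in> ?I \<and> f u = x" if x: "x \<in> nbrs E u" "x \<noteq> v" for x
    proof -
      have "nbrs E u = {x, v}"
      proof (rule sym, rule card_subset_eq[OF finite_nbrs[OF sg]])
        show "{x, v} \<subseteq> nbrs E u" using x(1) nb by auto
        then have "card {x, v} \<le> card (nbrs E u)" by (rule card_mono[OF finite_nbrs[OF sg]])
        then show "card {x, v} = card (nbrs E u)" using deg x(2) by (simp add: deg_def)
      qed
      moreover have "u \<in> ?I" by (rule inner_if_two_nbrs[OF uv(1) x(1) nb(1) x(2)])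
      ultimately show ?thesis using forcing_mapD(2)[OF f, of u] 3(1) by auto
    qed
    have uS: "u \<in> sources V E f"
    proof (rule ccontr)
      assume "u \<notin> sources V E f"
      then obtain x where x: "x \<in> ?I" "f x = u" using uv(1) by (auto simp: sources_def)
      then have "x \<noteq> v" "x \<in> nbrs E u"
        using 3(2) forcing_mapD(2)[OF f x(1)] nbrs_sym[of u E x] by auto
      then have "u \<in> ?I" "f u = x" using other by auto
      then show False using forcing_mapD(3)[OF f x(1)] x(2) by simp
    qed
    have notS: "x \<notin> sources V E f" if "x \<in> nbrs E u" "x \<noteq> v" for x
      using other[OF that] by (auto simp: sources_def)
    have vS: "v \<in> sources V E f"
      using forcing_mapD(4)[OF f uS] notS by blast
    define h where "h = f(w := u)"
    have h: "h w = u" "\<And>x. x \<noteq> w \<Longrightarrow> h x = f x" by (auto simp: h_def)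
    have hf: "h x = f x" if "x \<in> ?I" for x using h(2) that wI by metis
    have im: "h ` ?I = f ` ?I" using hf by (rule image_cong[OF refl])
    have S: "sources ?V ?E h = insert w (sources V E f - {u})"
      unfolding sources_def I image_insert im h(1) using fV w wne by auto
    have "forcing_map ?V ?E h"
    proof (rule forcing_mapI)
      have "inj_on h ?I" using forcing_mapD(1)[OF f] hf inj_on_cong[of ?I h f] by blast
      then show "inj_on h (inner ?V ?E)"
        unfolding I using uS wI im h(1) by (auto simp: inj_on_insert sources_def)
      show "h x \<in> nbrs ?E x" if "x \<in> inner ?V ?E" for x
      proof (cases "x = w")
        case True
        then show ?thesis using h by (simp add: n)
      next
        case False
        then have x: "x \<in> ?I" using \<open>x \<in> inner ?V ?E\<close> I by auto
        have "\<not> (x = v \<and> f x = u)" "\<not> (x = u \<and> f x = v)" using 3 x by auto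
        then show ?thesis using False h(2) forcing_mapD(2)[OF f x] by (auto simp: n)
      qed
      show "h (h x) \<noteq> x" if x: "x \<in> inner ?V ?E" "h x \<in> inner ?V ?E" for x
      proof (cases "x = w")
        case True
        then have "u \<in> ?I" using x(2) h(1) wne I by auto
        then have "h u \<in> V" using h(2)[of u] wne fV by auto
        then show ?thesis using True h(1) w by auto
      next
        case False
        then have "x \<in> ?I" "h x = f x" "f x \<noteq> w" using x I h fV w by auto
        moreover from this have "f x \<in> ?I" using x(2) I by auto
        ultimately show ?thesis using forcing_mapD(3)[OF f] h(2) by auto
      qed
      show "\<exists>t\<in>sources ?V ?E h. t \<in> nbrs ?E s" if s: "s \<in> sources ?V ?E h" for s
      proof -
        consider "s = w" | "s = v" | "s \<noteq> w" "s \<noteq> v" "s \<noteq> u" "s \<in> sources V E f"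
          using s S by auto
        then show ?thesis
        proof cases
          case 1
          then show ?thesis using S vS uv by (intro bexI[of _ v]) (auto simp: n)
        next
          case 2
          then show ?thesis using S uv wne by (intro bexI[of _ w]) (auto simp: n)
        next
          case 3
          then obtain t where t: "t \<in> sources V E f" "t \<in> nbrs E s"
            using forcing_mapD(4)[OF f] by blast
          have "t \<noteq> u" using notS[of s] 3 t(2) nbrs_sym[of t E s] by auto
          then show ?thesis using t 3 S by (intro bexI[of _ t]) (auto simp: n)
        qed
      qed
    qed
    then show ?thesis by blast
  qed
qed

text \<open>By symmetry let \<open>w\<close> force \<open>v\<close>. If \<open>u\<close> forces
  \<open>w\<close>, let \<open>u\<close> force \<open>v\<close> directly. Otherwise nobody forces
  \<open>w\<close>, so \<open>w\<close> is a source whose source neighbor is \<open>u\<close>; after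
  the contraction \<open>v\<close> takes its place beside \<open>u\<close>.\<close>

lemma forcing_map_unsubdiv:
  assumes sg: "simple_graph V E" and e: "{u, v} \<in> E" and w: "w \<notin> V"
    and ex: "\<exists>f. forcing_map (insert w V) (subdiv E u v w) f"
  shows "\<exists>f. forcing_map V E f"
proof -
  obtain f where f: "forcing_map (insert w V) (subdiv E u v w) f" using ex by blast
  have e': "{v, u} \<in> E" using e by (simp add: insert_commute)
  have main: "\<exists>f. forcing_map V E f"
    if e: "{u, v} \<in> E" and f: "forcing_map (insert w V) (subdiv E u v w) f" and fw: "f w = v"
    for u v f
  proof -
    let ?V = "insert w V" and ?E = "subdiv E u v w" and ?I = "inner V E"
    note n = nbrs_subdiv[OF sg e w]
    note I = inner_subdiv[OF sg e w]
    have uv: "u \<in> V" "v \<in> V" "u \<noteq> v" using nbrsD[OF sg, of v u] e by (auto simp: nbrs_def)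
    then have wne: "w \<noteq> u" "w \<noteq> v" using w by auto
    have nb: "v \<in> nbrs E u" "u \<in> nbrs E v" using e by (auto simp: nbrs_def insert_commute)
    have wI: "w \<notin> ?I" using w inner_subset[of V E] by auto
    have inj: "inj_on f (insert w ?I)" and fn: "\<And>x. x \<in> ?I \<Longrightarrow> f x \<in> nbrs ?E x"
      and cyc: "\<And>x. x \<in> insert w ?I \<Longrightarrow> f x \<in> insert w ?I \<Longrightarrow> f (f x) \<noteq> x"
      using forcing_mapD[OF f] unfolding I by auto
    have vf: "v \<notin> f ` ?I" using inj fw wI by (auto simp: inj_on_insert)
    have vu: "\<not> (x = v \<and> f x = u)" "\<not> (x = u \<and> f x = v)" if "x \<in> ?I" for x
      using fn[OF that] uv wne by (auto simp: n)
    have fE: "f x \<in> nbrs E x" if "x \<in> ?I" "f x \<noteq> w" for x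
      using fn[OF that(1)] that wI by (auto simp: n split: if_splits)
    \<comment> \<open>The neighbors of \<open>w\<close> are \<open>u\<close> and \<open>v\<close>,
      and \<open>v\<close> cannot force the vertex that forces it.\<close>
    have wpre: "x = u" if "x \<in> ?I" "f x = w" for x
    proof -
      have "x \<noteq> v" using cyc[of w] that fw by auto
      moreover have "w \<notin> nbrs E x" using nbrsD(1)[OF sg, of w x] w by blast
      ultimately show ?thesis using fn[OF that(1)] that wI by (auto simp: n split: if_splits)
    qed
    have fV: "f x \<in> V" if "x \<in> ?I" "f x \<noteq> w" for x using nbrsD(1)[OF sg fE[OF that]] .
    show ?thesis
    proof (cases "u \<in> ?I \<and> f u = w")
      case True
      then have u: "u \<in> ?I" "f u = w" by auto
      define h where "h = f(u := v)"
      have h: "h u = v" "\<And>x. x \<noteq> u \<Longrightarrow> h x = f x" by (auto simp: h_def)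
      have hf: "h x = f x" if "x \<in> ?I - {u}" for x using h(2) that by auto
      have hw: "f x \<noteq> w" if "x \<in> ?I - {u}" for x using wpre[of x] that by auto
      have Iu: "?I = insert u (?I - {u})" using u(1) by auto
      have im: "h ` (?I - {u}) = f ` (?I - {u})" using hf by (rule image_cong[OF refl])
      have "h ` ?I = insert v (f ` (?I - {u}))"
        by (subst Iu) (simp only: image_insert h(1) im)
      moreover have "f ` insert w ?I = insert v (insert w (f ` (?I - {u})))"
        by (subst Iu) (simp only: image_insert fw u(2))
      ultimately have S: "sources V E h = sources ?V ?E f"
        unfolding sources_def I using w by auto
      have "forcing_map V E h"
      proof (rule forcing_mapI)
        have "inj_on f (?I - {u})" using inj by (rule inj_on_subset) auto
        then have "inj_on h (?I - {u})" using hf inj_on_cong[of "?I - {u}" h f] by blast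
        moreover have "h u \<notin> h ` (?I - {u})" unfolding im h(1) using vf by auto
        ultimately have "inj_on h (insert u (?I - {u}))" by (subst inj_on_insert) simp
        then show "inj_on h ?I" using Iu by simp
        show "h x \<in> nbrs E x" if "x \<in> ?I" for x
          using that fE[OF that] hw[of x] h nb by (cases "x = u") auto
        show "h (h x) \<noteq> x" if x: "x \<in> ?I" "h x \<in> ?I" for x
        proof -
          consider "x = u" | "x \<noteq> u" "f x = u" | "x \<noteq> u" "f x \<noteq> u" by blast
          then show ?thesis
          proof cases
            case 1
            then have "v \<in> ?I" using x(2) h(1) by simp
            then show ?thesis using 1 h uv vu(1)[of v] by auto
          next
            case 2
            then show ?thesis using h vu(1)[OF x(1)] by auto
          next
            case 3
            then have "h x = f x" "h (h x) = f (f x)" using h by auto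
            then show ?thesis using cyc[of x] x by auto
          qed
        qed
        show "\<exists>t\<in>sources V E h. t \<in> nbrs E s" if s: "s \<in> sources V E h" for s
        proof -
          obtain t where t: "t \<in> sources ?V ?E f" "t \<in> nbrs ?E s"
            using forcing_mapD(4)[OF f] s S by auto
          have "t \<noteq> w" "s \<noteq> w" using S s t w by (auto simp: sources_def)
          then have "t \<in> nbrs E s" using t(2) by (auto simp: n split: if_splits)
          then show ?thesis using t S by auto
        qed
      qed
      then show ?thesis by blast
    next
      case False
      then have hw: "f x \<noteq> w" if "x \<in> ?I" for x using wpre[OF that] that by auto
      have wS: "w \<in> sources ?V ?E f"
        using hw fw wne by (auto simp: sources_def I)
      have vS: "v \<notin> sources ?V ?E f" using fw by (auto simp: sources_def I)
      have uS: "u \<in> sources ?V ?E f"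
        using forcing_mapD(4)[OF f wS] vS by (auto simp: n)
      have S: "sources V E f = insert v (sources ?V ?E f - {w})"
        unfolding sources_def I image_insert fw using vf w uv by auto
      have "forcing_map V E f"
      proof (rule forcing_mapI)
        show "inj_on f ?I" using inj by (rule inj_on_subset) auto
        show "f x \<in> nbrs E x" if "x \<in> ?I" for x using fE that hw by blast
        show "f (f x) \<noteq> x" if "x \<in> ?I" "f x \<in> ?I" for x using cyc that by blast
        show "\<exists>t\<in>sources V E f. t \<in> nbrs E s" if s: "s \<in> sources V E f" for s
        proof -
          consider "s = v" | "s = u" | "s \<noteq> v" "s \<noteq> u" "s \<noteq> w" "s \<in> sources ?V ?E f"
            using s S wne by auto
          then show ?thesis
          proof cases
            case 1
            then show ?thesis using S uS wne nb by auto
          next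
            case 2
            then show ?thesis using S nb by auto
          next
            case 3
            then obtain t where t: "t \<in> sources ?V ?E f" "t \<in> nbrs E s"
              using forcing_mapD(4)[OF f, of s] by (auto simp: n)
            then have "t \<noteq> w" using nbrsD(1)[OF sg] w by blast
            then show ?thesis using t S by auto
          qed
        qed
      qed
      then show ?thesis by blast
    qed
  qed
  have "w \<in> inner (insert w V) (subdiv E u v w)" unfolding inner_subdiv[OF sg e w] by simp
  from forcing_mapD(2)[OF f this] have "f w = u \<or> f w = v"
    by (auto simp: nbrs_subdiv[OF sg e w])
  then show ?thesis using main[OF e f] main[OF e' f[unfolded subdiv_commute[of E u]]] by blast
qed

section \<open>Forcing maps along the construction of the family\<close>

lemma family_F_forcing_map:
  assumes "family_F V E"
  shows "simple_graph V E \<and> (\<exists>f. forcing_map V E f)"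
  using assms
proof induction
  case (P2 a b)
  have sg: "simple_graph {a, b} {{a, b}}" using P2 by (simp add: simple_graph_def)
  have I: "inner {a, b} {{a, b}} = {}"
    using P2 by (auto simp: inner_def leaves_iff nbrs_insert[of a b "{}"])
  have "forcing_map {a, b} {{a, b}} id"
    using P2 by (auto simp: forcing_map_def sources_def I nbrs_insert[of a b "{}"])
  with sg show ?case by blast
next
  case (O1 V E u v w)
  then have e: "{v, u} \<in> E" by (simp add: insert_commute)
  have "\<exists>f. forcing_map (insert w V) (subdiv E u v w) f"
    using O1 forcing_map_subdiv[of V E u v w] forcing_map_subdiv[OF _ e, of V w]
    by (auto simp: subdiv_commute[of E v])
  then show ?case using simple_graph_subdiv[of V E u v w] O1 by (simp add: subdiv_def)
next
  case (O2 V E v w)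
  have "v \<in> V" using O2 by (simp add: strong_support_def)
  moreover from this have "v \<noteq> w" using O2 by auto
  ultimately have "simple_graph (insert w V) (insert {v, w} E)"
    using O2 by (auto simp: simple_graph_def)
  then show ?case using O2.IH forcing_map_O2[OF _ _ O2.hyps(2,3)] by blast
next
  case (O3 V E w v x y)
  have "v \<in> V" using O3 by (auto simp: leaves_def)
  moreover from this have "v \<noteq> x" "v \<noteq> y" using O3.hyps(5) by auto
  ultimately have "simple_graph (V \<union> {x, y}) (E \<union> {{v, x}, {v, y}})"
    using O3 by (intro simple_graph_Un) auto
  then show ?case using O3.IH forcing_map_O3[OF _ _ O3.hyps(2-5)] by blast
next
  case (O4 V E v x y z)
  from O4.hyps(2,5) have "v \<noteq> y" by auto
  with O4 have "simple_graph (V \<union> {x, y, z}) (E \<union> {{x, y}, {y, z}, {v, y}})"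
    by (intro simple_graph_Un) auto
  then show ?case using O4.IH forcing_map_O4[OF _ _ O4.hyps(2-5)] by blast
next
  case (O5 V E v u1 v1 v2 v3 v4 u3)
  have "simple_graph (V \<union> {u1, v1, v2, v3, v4, u3})
     (E \<union> {{u1, v1}, {v1, v2}, {v2, v3}, {v3, v4}, {v3, u3}, {v, v1}})"
  proof (rule simple_graph_Un)
    fix e assume e: "e \<in> {{u1, v1}, {v1, v2}, {v2, v3}, {v3, v4}, {v3, u3}, {v, v1}}"
    have "v \<noteq> v1" using O5 by auto
    then show "e \<subseteq> V \<union> {u1, v1, v2, v3, v4, u3} \<and> card e = 2"
      using e O5(2,4) by (elim insertE emptyE) simp_all
  qed (use O5 in auto)
  then show ?case using O5.IH forcing_map_O5[OF _ _ O5.hyps(2-5)] by blast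
qed

subsection \<open>Reductions\<close>

text \<open>Only \<open>v\<close> could have its parent in \<open>W\<close> without lying there.
  That parent would be \<open>a\<close>, and \<open>a\<close> and \<open>v\<close> would be parents
  of each other.\<close>

lemma rooted_del_branch:
  assumes B: "branch V E W a v" and T: "rooted V E r p d" and "r \<notin> W" "p a = v"
  shows "rooted (V - W) (del E W) r p d"
proof (rule rooted_del[OF T \<open>r \<notin> W\<close>], rule ccontr)
  have W: "W \<subseteq> V" "a \<in> W" "nbrs E v \<inter> W = {a}" "\<And>x. x \<in> W \<Longrightarrow> nbrs E x \<subseteq> insert v W"
    using B by (auto simp: branch_def)
  fix u assume u: "u \<in> V" "u \<noteq> r" "p u \<in> W" "u \<notin> W"
  have pu: "p u \<in> nbrs E u" using rooted_parent[OF T u(1,2)] by blast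
  then have "u \<in> nbrs E (p u)" by (simp add: nbrs_sym[of u])
  then have "u = v" using W(4)[OF u(3)] u(4) by blast
  then have "p v = a" using W(3) pu u(3) by blast
  moreover have "d (p a) < d a" "d (p v) < d v"
    using rooted_parent[OF T] W(1,2) \<open>r \<notin> W\<close> u(1,2) \<open>u = v\<close> by blast+
  ultimately show False using \<open>p a = v\<close> by simp
qed

text \<open>The induction hypothesis as handed to the reductions. Parents vary while root and rank
  are fixed, because undoing O1 moves a vertex to a new parent of smaller rank.\<close>

definition smaller_in_F :: "'a set \<Rightarrow> 'a \<Rightarrow> ('a \<Rightarrow> nat) \<Rightarrow> bool" where
  "smaller_in_F V r d \<longleftrightarrow> (\<forall>V' E' p. card V' < card V \<longrightarrow> rooted V' E' r p d \<longrightarrow>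
     deg E' r = 1 \<longrightarrow> (\<exists>f. forcing_map V' E' f) \<longrightarrow> family_F V' E')"

text \<open>The common part of undoing O2, O4 and O5. The cut edge is the only link, so only
  \<open>v\<close> can lose a source neighbor, and only if \<open>a\<close> is a source. Degree 3 at
  \<open>v\<close> leaves the degree 2 that O4 and O5 demand.\<close>

lemma reduce_branch:
  assumes B: "branch V E W a v" and T: "rooted V E r p d" and W: "r \<notin> W" "p a = v"
    and deg: "deg E v \<ge> 3" "deg E r = 1" and f: "forcing_map V E f"
    and fW: "\<And>x. x \<in> inner V E \<inter> W \<Longrightarrow> f x \<in> W" and fv: "f v \<noteq> a"
    and src: "v \<in> sources V E f \<Longrightarrow> a \<in> sources V E f \<Longrightarrow>
      \<exists>t\<in>sources V E f - W. t \<in> nbrs E v"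
    and IH: "smaller_in_F V r d"
  shows "family_F (V - W) (del E W)" "deg (del E W) v \<ge> 2"
proof -
  note sg = rooted_simple[OF T]
  have WV: "W \<subseteq> V" "a \<in> W" "v \<in> V - W" "nbrs E v \<inter> W = {a}"
    "\<And>x. x \<in> W \<Longrightarrow> nbrs E x \<subseteq> insert v W"
    using B by (auto simp: branch_def)
  show deg2: "deg (del E W) v \<ge> 2" using branch_deg[OF B] deg(1) by simp
  have out: "s = v \<and> t = a" if "t \<in> nbrs E s" "t \<in> W" "s \<notin> W" for s t
  proof -
    have "s = v" using that WV(5)[OF that(2)] nbrs_sym[of t E s] by blast
    then show ?thesis using that WV(4) by blast
  qed
  have "forcing_map (V - W) (del E W) f"
  proof (rule forcing_map_del[OF f branch_inner(2)[OF B deg2]])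
    show "f x \<in> W \<longleftrightarrow> x \<in> W" if "x \<in> inner V E" for x
      using fW that out[OF forcing_mapD(2)[OF f that]] fv by blast
    show "\<exists>t\<in>sources V E f - W. t \<in> nbrs E s" if s: "s \<in> sources V E f - W" for s
    proof -
      obtain t where t: "t \<in> sources V E f" "t \<in> nbrs E s"
        using forcing_mapD(4)[OF f] s by blast
      show ?thesis
      proof (cases "t \<in> W")
        case True
        then show ?thesis using out[OF t(2) True] s t src by auto
      qed (use t in blast)
    qed
  qed
  moreover have "v \<noteq> r" using deg by auto
  then have "deg (del E W) r = 1"
    using branch_nbrs[OF B] T W(1) deg(2) by (auto simp: deg_def rooted_def)
  moreover have "V - W \<subset> V" using WV(1,2) by blast
  then have "card (V - W) < card V" using T by (intro psubset_card_mono) (auto simp: rooted_def)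
  ultimately show "family_F (V - W) (del E W)"
    using IH rooted_del_branch[OF B T W] unfolding smaller_in_F_def by blast
qed

lemma Diff_Un_cancel: "W \<subseteq> V \<Longrightarrow> V - W \<union> W = V"
  by blast

text \<open>Since the root is a leaf, \<open>w\<close> has a parent and a single child
  \<open>c\<close>. Contracting at \<open>w\<close> makes \<open>c\<close> a child of
  \<open>p w\<close>; ranks still decrease along this edge.\<close>

lemma reduce_O1:
  assumes T: "rooted V E r p d" and "deg E r = 1" and ex: "\<exists>f. forcing_map V E f"
    and w: "w \<in> V" "nbrs E w = {u, v}" "u \<noteq> v" and deg: "deg E u \<le> 2"
    and IH: "smaller_in_F V r d"
  shows "family_F V E"
proof -
  note sg = rooted_simple[OF T]
  have fin: "finite V" using T by (simp add: rooted_def)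
  have wr: "w \<noteq> r" using w \<open>deg E r = 1\<close> by (auto simp: deg_def)
  obtain c where c: "{c, p w} = {u, v}" "c \<noteq> p w"
    using rooted_parent[OF T w(1) wr] w(2,3) by (metis doubleton_eq_iff insertE singletonD)
  have nw: "nbrs E w = {c, p w}" using w(2) c(1) by simp
  have dp: "d (p w) < d w" "p w \<in> V" using rooted_parent[OF T w(1) wr] by auto
  have "c \<in> nbrs E w" using nw by simp
  then have cw: "c \<in> V" "c \<noteq> r" "w = p c" using c(2) by (auto simp: rooted_nbrs[OF T])
  then have dc: "d w < d c" using rooted_parent[OF T] by blast
  have uniq: "x = c" if "x \<in> V" "x \<noteq> r" "p x = w" for x
  proof -
    have "x \<in> nbrs E w" using that by (auto simp: rooted_nbrs[OF T])
    moreover have "x \<noteq> p w" using rooted_parent[OF T that(1,2)] dp that(3) by auto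
    ultimately show ?thesis using nw by blast
  qed
  \<comment> \<open>Subdividing removes the edge \<open>{c, p w}\<close>, so \<open>E\<close> is
    recovered only if it does not contain that edge.\<close>
  have ncp: "{c, p w} \<notin> E"
  proof
    assume "{c, p w} \<in> E"
    then have "p w \<in> nbrs E c" by (simp add: nbrs_def)
    then have "p w = w \<or> c = p (p w) \<and> p w \<in> V \<and> p w \<noteq> r"
      using cw by (auto simp: rooted_nbrs[OF T])
    then show False using dp dc rooted_parent[OF T, of "p w"] by auto
  qed
  define V' where "V' = V - {w}"
  define p' where "p' = p(c := p w)"
  define E' where "E' = (\<lambda>x. {x, p' x}) ` (V' - {r})"
  have p': "p' c = p w" "\<And>x. x \<noteq> c \<Longrightarrow> p' x = p x" by (auto simp: p'_def)
  have split: "V - {r} = insert w (insert c (V - {r, w, c}))" "V' - {r} = insert c (V - {r, w, c})"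
    using cw w(1) wr dc by (auto simp: V'_def)
  let ?R = "(\<lambda>x. {x, p x}) ` (V - {r, w, c})"
  have im': "(\<lambda>x. {x, p' x}) ` (V - {r, w, c}) = ?R"
    using p'(2) by (intro image_cong) auto
  have E'R: "E' = insert {c, p w} ?R"
    unfolding E'_def split(2) image_insert im' p'(1) ..
  have "E = (\<lambda>x. {x, p x}) ` (V - {r})" using T by (simp add: rooted_def)
  then have ER: "E = insert {w, p w} (insert {c, w} ?R)"
    unfolding split(1) image_insert using cw(3) by simp
  have sub: "E = subdiv E' c (p w) w"
    using ncp unfolding subdiv_def E'R ER by auto
  have V: "V = insert w V'" "w \<notin> V'" using w(1) by (auto simp: V'_def)
  have "p' x \<in> V' \<and> d (p' x) < d x" if x: "x \<in> V' - {r}" for x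
  proof (cases "x = c")
    case True
    then show ?thesis using dp dc p'(1) by (auto simp: V'_def)
  next
    case False
    then have "p x \<noteq> w" using uniq[of x] x by (auto simp: V'_def)
    then show ?thesis using rooted_parent[OF T, of x] x p'(2)[OF False] by (auto simp: V'_def)
  qed
  then have T': "rooted V' E' r p' d"
    using T wr unfolding rooted_def E'_def by (auto simp: V'_def)
  note sg' = rooted_simple[OF T']
  have e': "{c, p w} \<in> E'" using E'R by simp
  have degE: "deg E x = deg E' x" if "x \<in> V'" for x
    using deg_subdiv[OF sg' e' V(2) that] sub by simp
  have cp': "c \<in> V'" "p w \<in> V'" using cw(1) dc dp by (auto simp: V'_def)
  have "u = c \<or> u = p w" using c(1) by auto
  then have d2: "deg E' c \<le> 2 \<or> deg E' (p w) \<le> 2" using deg degE cp' by auto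
  have "card V' < card V" using fin w(1) unfolding V'_def by (metis card_Diff1_less)
  moreover have "deg E' r = 1" using degE[of r] \<open>deg E r = 1\<close> T' by (simp add: rooted_def)
  moreover have "\<exists>f. forcing_map V' E' f"
    using forcing_map_unsubdiv[OF sg' e' V(2)] ex unfolding V(1)[symmetric] sub[symmetric] .
  ultimately have "family_F V' E'" using IH T' unfolding smaller_in_F_def by blast
  from family_F.O1[OF this e' d2 V(2)] show ?thesis
    unfolding V(1)[symmetric] using sub by (simp add: subdiv_def)
qed

text \<open>The map is chosen so that \<open>v\<close> does not force the leaf to be removed. The
  leaves \<open>l1\<close> and \<open>l2\<close> stay and keep \<open>v\<close> a strong support
  vertex; the root may be one of them.\<close>

lemma reduce_O2:
  assumes T: "rooted V E r p d" and deg: "deg E r = 1" and ex: "\<exists>f. forcing_map V E f"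
    and l: "l \<in> leaves V E" "v \<in> nbrs E l" "l \<noteq> r"
    and l1: "l1 \<in> leaves V E" "v \<in> nbrs E l1" and l2: "l2 \<in> leaves V E" "v \<in> nbrs E l2"
    and dist: "l \<noteq> l1" "l \<noteq> l2" "l1 \<noteq> l2"
    and IH: "smaller_in_F V r d"
  shows "family_F V E"
proof -
  note sg = rooted_simple[OF T]
  obtain f where f: "forcing_map V E f" "f v \<noteq> l"
    using forcing_map_avoid_leaf[OF sg ex l(1,2) l1 dist(1)] by blast
  have nl: "nbrs E l = {v}" using leaf_nbrs[OF l(1,2)] .
  have lV: "l \<in> V" "v \<in> V" "l \<noteq> v" using nbrsD[OF sg l(2)] by auto
  have nv: "l \<in> nbrs E v" "l1 \<in> nbrs E v" "l2 \<in> nbrs E v"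
    using l(2) l1(2) l2(2) by (simp_all add: nbrs_sym[of _ E v])
  have B: "branch V E {l} l v" using sg lV nl nv by (auto simp: branch_def)
  have pl: "p l = v" using rooted_parent[OF T lV(1) l(3)] nl by auto
  have "card {l, l1, l2} \<le> card (nbrs E v)"
    using nv finite_nbrs[OF sg] by (intro card_mono) auto
  then have deg3: "deg E v \<ge> 3" using dist by (simp add: deg_def)
  \<comment> \<open>At most one of \<open>l1\<close> and \<open>l2\<close> is forced by
    \<open>v\<close>; the other remains as its source neighbor.\<close>
  have src: "\<exists>t\<in>sources V E f - {l}. t \<in> nbrs E v"
  proof (cases "f v = l1")
    case True
    then have "l2 \<in> sources V E f" using leaf_source(1)[OF f(1) l2] dist by auto
    then show ?thesis using nv dist by auto
  next
    case False
    then have "l1 \<in> sources V E f" using leaf_source(1)[OF f(1) l1] by auto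
    then show ?thesis using nv dist by auto
  qed
  have rl: "r \<notin> {l}" using l(3) by simp
  have fW: "f x \<in> {l}" if "x \<in> inner V E \<inter> {l}" for x using that l(1) by (auto simp: inner_def)
  have R: "family_F (V - {l}) (del E {l})" "deg (del E {l}) v \<ge> 2"
    using reduce_branch[OF B T rl pl deg3 deg f(1) fW f(2) src IH] by blast+
  have sg': "simple_graph (V - {l}) (del E {l})" using simple_graph_del[OF sg] .
  have "strong_support (V - {l}) (del E {l}) v"
    unfolding strong_support_iff[OF sg'] branch_inner(1)[OF B R(2)]
    using l1 l2 dist nl by (intro exI[of _ l1] exI[of _ l2]) (auto simp: nbrs_del lV(3)[symmetric])
  from family_F.O2[OF R(1) this, of l] have "family_F (insert l (V - {l})) (insert {v, l} (del E {l}))"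
    by simp
  moreover have "insert l (V - {l}) = V" using lV by auto
  moreover have "del E {l} \<union> {{v, l}} = E"
    using nl nv(1) by (intro del_Un[OF sg]) (auto simp: nbrs_def insert_commute)
  ultimately show ?thesis by simp
qed

text \<open>The pendant piece that O3, O4 and O5 all create, and the one found at the bottom of a
  tree where neither O1 nor O2 can be undone.\<close>

definition cherry :: "'a set \<Rightarrow> 'a set set \<Rightarrow> 'a \<Rightarrow> 'a \<Rightarrow> 'a \<Rightarrow> 'a \<Rightarrow> bool" where
  "cherry V E c x y q \<longleftrightarrow> nbrs E c = {x, y, q} \<and> distinct [x, y, q] \<and>
     x \<in> leaves V E \<and> y \<in> leaves V E \<and> q \<in> inner V E"

lemma cherryD:
  assumes "simple_graph V E" "cherry V E c x y q"
  shows "nbrs E c = {x, y, q}" "nbrs E x = {c}" "nbrs E y = {c}" "c \<in> nbrs E q"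
    "x \<noteq> y" "x \<noteq> q" "y \<noteq> q" "c \<noteq> x" "c \<noteq> y" "c \<noteq> q"
    "x \<in> leaves V E" "y \<in> leaves V E" "x \<in> V" "y \<in> V" "c \<in> V" "q \<in> V"
    "c \<in> inner V E" "q \<in> inner V E"
proof -
  have c: "nbrs E c = {x, y, q}" "x \<noteq> y" "x \<noteq> q" "y \<noteq> q" "x \<in> leaves V E" "y \<in> leaves V E"
    "q \<in> inner V E" using assms(2) by (auto simp: cherry_def)
  then show "nbrs E c = {x, y, q}" "x \<noteq> y" "x \<noteq> q" "y \<noteq> q" "x \<in> leaves V E" "y \<in> leaves V E"
    "q \<in> inner V E" by simp_all
  have n: "x \<in> nbrs E c" "y \<in> nbrs E c" "q \<in> nbrs E c" using c(1) by auto
  show "nbrs E x = {c}" "nbrs E y = {c}" "c \<in> nbrs E q"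
    using n leaf_nbrs[OF c(5), of c] leaf_nbrs[OF c(6), of c] by (auto simp: nbrs_sym[of c])
  show "c \<noteq> x" "c \<noteq> y" "c \<noteq> q" "x \<in> V" "y \<in> V" "c \<in> V" "q \<in> V"
    using nbrsD[OF assms(1) n(1)] nbrsD[OF assms(1) n(2)] nbrsD[OF assms(1) n(3)] by auto
  then show "c \<in> inner V E" using inner_if_two_nbrs[OF _ n(1,2) c(2)] by blast
qed

lemma cherry_source:
  assumes "simple_graph V E" "cherry V E c x y q" "forcing_map V E f"
  shows "c \<in> sources V E f"
  using two_leaves_source[OF assms(3), of x c y] cherryD[OF assms(1,2)] by simp

lemma cherry_not_root:
  assumes T: "rooted V E r p d" and c: "cherry V E c x y q" and "p c = q" "deg E r = 1"
  shows "r \<notin> {c, x, y}"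
proof -
  note C = cherryD[OF rooted_simple[OF T] c]
  have "c \<noteq> r" using C(17) assms(4) by (auto simp: inner_def leaves_def)
  moreover have "x \<in> nbrs E c" "y \<in> nbrs E c" using C(1) by auto
  then have "x \<noteq> r" "y \<noteq> r" using C(6,7) assms(3) by (auto simp: rooted_nbrs[OF T])
  ultimately show ?thesis by auto
qed

text \<open>The cut edge must carry no arrow: \<open>c\<close> does not force \<open>q\<close> by
  assumption, and \<open>q\<close> does not force the source \<open>c\<close>. The last condition on
  \<open>q\<close> provides for the loss of \<open>c\<close> as a source neighbor.\<close>

lemma reduce_O4:
  assumes T: "rooted V E r p d" and deg: "deg E r = 1" and f: "forcing_map V E f"
    and c: "cherry V E c x y q" and pc: "p c = q" and deg3: "deg E q \<ge> 3" and fc: "f c \<noteq> q"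
    and src: "q \<in> sources V E f \<Longrightarrow> \<exists>t\<in>sources V E f - {c, x, y}. t \<in> nbrs E q"
    and IH: "smaller_in_F V r d"
  shows "family_F V E"
proof -
  note sg = rooted_simple[OF T]
  note C = cherryD[OF sg c]
  let ?W = "{x, c, y}"
  have "x \<notin> nbrs E q" "y \<notin> nbrs E q" using C nbrs_sym[of _ E q] by auto
  then have B: "branch V E ?W c q"
    using sg C by (auto simp: branch_def)
  have rW: "r \<notin> ?W" using cherry_not_root[OF T c pc deg] by auto
  have fW: "f z \<in> ?W" if "z \<in> inner V E \<inter> ?W" for z
    using that forcing_mapD(2)[OF f, of c] C fc by (auto simp: inner_def)
  have fq: "f q \<noteq> c" using cherry_source[OF sg c f] C(18) by (auto simp: sources_def)
  have "{c, x, y} = ?W" by auto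
  then have src': "\<exists>t\<in>sources V E f - ?W. t \<in> nbrs E q" if "q \<in> sources V E f"
    using src[OF that] by simp
  have R: "family_F (V - ?W) (del E ?W)" "deg (del E ?W) q \<ge> 2"
    using reduce_branch[OF B T rW pc deg3 deg f fW fq src' IH] by blast+
  have "family_F (V - ?W \<union> ?W) (del E ?W \<union> {{x, c}, {c, y}, {q, c}})"
    using C by (intro family_F.O4[OF R(1) _ R(2)]) auto
  moreover have "V - ?W \<union> ?W = V" using C by (intro Diff_Un_cancel) auto
  moreover have "del E ?W \<union> {{x, c}, {c, y}, {q, c}} = E"
  proof (rule del_Un[OF sg])
    show "{{x, c}, {c, y}, {q, c}} \<subseteq> E"
      using C(1,2,4) nbrs_sym[of y E c] by (auto simp: nbrs_def)
    show "{a, b} \<in> {{x, c}, {c, y}, {q, c}}" if "a \<in> ?W" "b \<in> nbrs E a" for a b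
      using that C(1-3) by (auto simp: doubleton_eq_iff)
  qed
  ultimately show ?thesis by simp
qed

text \<open>Removing \<open>x\<close> and \<open>y\<close> turns \<open>c\<close> into a leaf, so
  \<open>c\<close> forces nothing any more. If it forced \<open>q\<close>, then \<open>q\<close>
  becomes a source, otherwise \<open>q\<close> is one by assumption; so \<open>c\<close> and
  \<open>q\<close> serve each other. The leaves \<open>c\<close> and \<open>l\<close> make
  \<open>q\<close> a strong support vertex.\<close>

lemma reduce_O3:
  assumes T: "rooted V E r p d" and deg: "deg E r = 1" and f: "forcing_map V E f"
    and c: "cherry V E c x y q" and pc: "p c = q" and l: "l \<in> leaves V E" "q \<in> nbrs E l"
    and fc: "f c = q \<or> q \<in> sources V E f"
    and IH: "smaller_in_F V r d"
  shows "family_F V E"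
proof -
  note sg = rooted_simple[OF T]
  note C = cherryD[OF sg c]
  let ?W = "{x, y}" and ?I = "inner V E"
  let ?V = "V - ?W" and ?E = "del E ?W"
  have fin: "finite V" using T by (simp add: rooted_def)
  have rW: "r \<notin> ?W" "r \<noteq> c" using cherry_not_root[OF T c pc deg] by auto
  have nx: "z = c" if "x \<in> nbrs E z \<or> y \<in> nbrs E z" for z
    using that C(2,3) nbrs_sym[of _ E z] by auto
  have nE: "nbrs ?E z = nbrs E z" if "z \<in> V - ?W" "z \<noteq> c" for z
    using that nx[of z] by (auto simp: nbrs_del)
  have nc: "nbrs ?E c = {q}" using C by (auto simp: nbrs_del)
  have "z \<in> inner ?V ?E \<longleftrightarrow> z \<in> ?I - {c}" for z
  proof (cases "z \<in> V - ?W \<and> z \<noteq> c")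
    case True
    then show ?thesis using nE[of z] by (auto simp: inner_def leaves_iff)
  next
    case False
    then show ?thesis using nc C(11,12) by (auto simp: inner_def leaves_iff)
  qed
  then have I: "inner ?V ?E = ?I - {c}" by blast
  have cS: "c \<in> sources V E f" by (rule cherry_source[OF sg c f])
  have fcn: "f c \<in> {x, y, q}" using forcing_mapD(2)[OF f C(17)] C(1) by simp
  have im: "f ` (?I - {c}) = f ` ?I - {f c}"
    using inj_on_image_set_diff[OF forcing_mapD(1)[OF f], of ?I "{c}"] C(17) by auto
  \<comment> \<open>The vertex that \<open>c\<close> used to force becomes a source, unless it is
    one of the removed leaves.\<close>
  have S: "sources ?V ?E f = (sources V E f \<union> {f c}) - ?W"
    unfolding sources_def I im using fcn C(13-16) by auto
  have qS: "q \<in> sources ?V ?E f" using S fc C(6,7) by auto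
  have cS': "c \<in> sources ?V ?E f" using S cS C(8,9) by auto
  have "forcing_map ?V ?E f"
  proof (rule forcing_mapI, unfold I)
    show "inj_on f (?I - {c})" using forcing_mapD(1)[OF f] by (rule inj_on_diff)
    have zV: "z \<in> V - ?W" if "z \<in> ?I" for z
      using that C(11,12) by (auto simp: inner_def)
    show "f z \<in> nbrs ?E z" if "z \<in> ?I - {c}" for z
      using that forcing_mapD(2)[OF f, of z] nE[of z] zV[of z] by simp
    show "f (f z) \<noteq> z" if "z \<in> ?I - {c}" "f z \<in> ?I - {c}" for z
      using that forcing_mapD(3)[OF f, of z] by simp
    show "\<exists>t\<in>sources ?V ?E f. t \<in> nbrs ?E s" if s: "s \<in> sources ?V ?E f" for s
    proof -
      consider "s = c" | "s = q" | "s \<noteq> c" "s \<noteq> q" by blast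
      then show ?thesis
      proof cases
        case 1
        then show ?thesis using qS nc by auto
      next
        case 2
        then show ?thesis using cS' C(4,6-10) nE[of q] C(16) by auto
      next
        case 3
        then have sS: "s \<in> sources V E f" "s \<in> V - ?W" using s S fcn by (auto simp: sources_def)
        then obtain t where t: "t \<in> sources V E f" "t \<in> nbrs E s"
          using forcing_mapD(4)[OF f] by blast
        then have "t \<notin> ?W" using nx[of s] 3(1) by auto
        then show ?thesis using S t nE[OF sS(2) 3(1)] by auto
      qed
    qed
  qed
  moreover have "rooted ?V ?E r p d"
  proof (rule rooted_del[OF T rW(1)])
    fix u assume u: "u \<in> V" "u \<noteq> r" "p u \<in> ?W"
    then have "p u \<in> nbrs E u" using rooted_parent[OF T] by blast
    then have "u = c" using nx[of u] u(3) by auto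
    then show "u \<in> ?W" using pc u(3) C(6,7) by auto
  qed
  moreover have "deg ?E r = 1"
    using nE[of r] rW T deg by (auto simp: deg_def rooted_def)
  moreover have "?V \<subset> V" using C by auto
  then have "card ?V < card V" using fin by (rule psubset_card_mono[rotated])
  ultimately have F: "family_F ?V ?E" using IH unfolding smaller_in_F_def by blast
  have sg': "simple_graph ?V ?E" by (rule simple_graph_del[OF sg])
  have lV: "l \<in> V" "nbrs E l = {q}" using l leaf_nbrs[OF l] by (auto simp: leaves_def)
  then have lc: "l \<noteq> c" "l \<noteq> x" "l \<noteq> y" using C by auto
  have cl: "c \<in> leaves ?V ?E" using nc C(8,9,15) by (auto simp: leaves_iff)
  have ll: "l \<in> leaves ?V ?E" "q \<in> nbrs ?E l" using lV lc nE[of l] by (auto simp: leaves_iff)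
  have "strong_support ?V ?E q"
    unfolding strong_support_iff[OF sg'] using cl ll lc(1) nc by blast
  moreover have "c \<in> nbrs ?E q \<inter> leaves ?V ?E" using cl nc nbrs_sym[of c ?E q] by auto
  ultimately have "family_F (?V \<union> ?W) (?E \<union> {{c, x}, {c, y}})"
    using C by (intro family_F.O3[OF F]) auto
  moreover have "?V \<union> ?W = V" using C by (intro Diff_Un_cancel) auto
  moreover have "?E \<union> {{c, x}, {c, y}} = E"
  proof (rule del_Un[OF sg])
    show "{{c, x}, {c, y}} \<subseteq> E" using C(1) by (auto simp: nbrs_def)
    show "{a, b} \<in> {{c, x}, {c, y}}" if "a \<in> ?W" "b \<in> nbrs E a" for a b
      using that C(2,3) by (auto simp: doubleton_eq_iff)
  qed
  ultimately show ?thesis by simp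
qed

text \<open>As \<open>q\<close> forces \<open>s\<close> and \<open>s\<close> forces
  \<open>u\<close>, injectivity keeps \<open>t\<close> from forcing \<open>s\<close>, so no arrow
  crosses the edge between \<open>s\<close> and \<open>t\<close>. Being forced, \<open>s\<close> is
  not a source that \<open>t\<close> could miss.\<close>

lemma reduce_O5:
  assumes T: "rooted V E r p d" and deg: "deg E r = 1" and f: "forcing_map V E f"
    and c: "cherry V E c x y q" and q: "nbrs E q = {c, s}" "c \<noteq> s"
    and s: "nbrs E s = {q, u, t}" and u: "u \<in> leaves V E" and dist: "distinct [q, u, t]"
    and p: "p c = q" "p q = s" "p s = t" and t: "t \<in> inner V E" "t \<noteq> c" "deg E t \<ge> 3"
    and fs: "f s = u" "f q = s"
    and IH: "smaller_in_F V r d"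
  shows "family_F V E"
proof -
  note sg = rooted_simple[OF T]
  note C = cherryD[OF sg c]
  let ?W = "{u, s, q, c, x, y}"
  have inV: "s \<in> V" "t \<in> V" "u \<in> V" "s \<noteq> q" "s \<noteq> u" "s \<noteq> t" "q \<noteq> u" "q \<noteq> t" "u \<noteq> t"
    using nbrsD[OF sg, of _ s] s dist by auto
  have nu: "nbrs E u = {s}" using leaf_nbrs[OF u] s nbrs_sym[of s E u] by auto
  have sI: "s \<in> inner V E"
    using inner_if_two_nbrs[OF inV(1), of q E u] s inV(7) by auto
  have leafne: "a \<noteq> b" if "a \<in> inner V E" "b \<in> leaves V E" for a b
    using that by (auto simp: inner_def)
  have D: "distinct [u, s, q, c, x, y]" "t \<notin> ?W"
    using inV C t(1,2) q(2) nu sI leafne u by (auto simp: inner_def)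
  have "s \<in> nbrs E t" using s nbrs_sym[of s E t] by auto
  moreover have "z = s" if "z \<in> ?W" "z \<in> nbrs E t" for z
  proof -
    have tz: "t \<in> nbrs E z" using that(2) nbrs_sym[of t E z] by simp
    show ?thesis using that(1) tz D(2) nu q(1) C(1-3) inV by (elim insertE emptyE) auto
  qed
  moreover have "nbrs E z \<subseteq> insert t ?W" if "z \<in> ?W" for z
    using that nu q(1) C(1-3) s by (elim insertE emptyE) auto
  ultimately have B: "branch V E ?W s t"
    using sg C inV D(2) unfolding branch_def by auto
  have tI: "f t \<noteq> s"
    using forcing_mapD(1)[OF f] t(1) C(18) fs(2) inV(8) by (auto simp: inj_on_def)
  have fW: "f z \<in> ?W" if "z \<in> inner V E \<inter> ?W" for z
  proof -
    have "z = s \<or> z = q \<or> z = c" using that u C(11,12) by (auto simp: inner_def)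
    then show ?thesis using fs forcing_mapD(2)[OF f C(17)] C(1) by auto
  qed
  have sS: "s \<notin> sources V E f" using fs(2) C(18) by (auto simp: sources_def)
  have rW: "r \<notin> ?W"
  proof -
    have "r \<noteq> s" "r \<noteq> q" using sI C(18) deg by (auto simp: inner_def leaves_def)
    moreover have "u \<in> nbrs E s" using s by auto
    then have "u \<noteq> r" using inV p(3) by (auto simp: rooted_nbrs[OF T])
    ultimately show ?thesis using cherry_not_root[OF T c p(1) deg] by auto
  qed
  have R: "family_F (V - ?W) (del E ?W)" "deg (del E ?W) t \<ge> 2"
    using reduce_branch[OF B T rW p(3) t(3) deg f fW tI _ IH] sS by blast+
  \<comment> \<open>In O5 the vertices \<open>u\<close>, \<open>s\<close>, \<open>q\<close>,
    \<open>c\<close>, \<open>x\<close>, \<open>y\<close> play the roles of \<open>u1\<close>,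
    \<open>v1\<close>, \<open>v2\<close>, \<open>v3\<close>, \<open>v4\<close>,
    \<open>u3\<close>.\<close>
  let ?F = "{{u, s}, {s, q}, {q, c}, {c, x}, {c, y}, {t, s}}"
  have "family_F (V - ?W \<union> ?W) (del E ?W \<union> ?F)"
    using D inV(2) by (intro family_F.O5[OF R(1) _ R(2)]) auto
  moreover have "V - ?W \<union> ?W = V" using C inV by (intro Diff_Un_cancel) auto
  moreover have "del E ?W \<union> ?F = E"
  proof (rule del_Un[OF sg])
    have "s \<in> nbrs E u" "q \<in> nbrs E s" "c \<in> nbrs E q" "x \<in> nbrs E c" "y \<in> nbrs E c" "s \<in> nbrs E t"
      using nu s q(1) C(1) \<open>s \<in> nbrs E t\<close> by auto
    then show "?F \<subseteq> E" by (auto simp: nbrs_def)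
    show "{a, b} \<in> ?F" if "a \<in> ?W" "b \<in> nbrs E a" for a b
      using that nu s q(1) C(1-3) by (elim insertE emptyE) (auto simp: doubleton_eq_iff)
  qed
  ultimately show ?thesis by simp
qed

section \<open>Every tree with a forcing map belongs to the family\<close>

lemma forcing_map_family_F:
  assumes "rooted V E r p d" "deg E r = 1" "\<exists>f. forcing_map V E f"
  shows "family_F V E"
  using assms
proof (induction "card V" arbitrary: V E p d rule: less_induct)
  case less
  note T0 = less.prems(1) and deg_r = less.prems(2)
  obtain h :: "'a \<Rightarrow> nat" where h: "h r = 0" "\<And>v. v \<in> V - {r} \<Longrightarrow> h v = Suc (h (p v))"
    using rooted_depth[OF T0] by blast
  \<comment> \<open>From here on the rank is the true depth, so that equal values mean equal
    levels.\<close>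
  have T: "rooted V E r p h" using T0 h(2) by (simp add: rooted_def)
  note sg = rooted_simple[OF T]
  have fin: "finite V" and rV: "r \<in> V" using T by (auto simp: rooted_def)
  have IH: "smaller_in_F V r h" using less.hyps unfolding smaller_in_F_def by blast
  obtain f where f: "forcing_map V E f" using less.prems(3) by blast
  obtain b where b: "nbrs E r = {b}" using deg_r by (auto simp: deg_def card_1_singleton_iff)
  have "b \<in> nbrs E r" using b by simp
  then have bV: "b \<in> V" "b \<noteq> r" "p b = r" by (auto simp: rooted_nbrs[OF T])
  have rl: "r \<in> leaves V E" using deg_r rV by (simp add: leaves_def)
  show ?case
  proof (rule ccontr)
    \<comment> \<open>Under this assumption every reduction turns into a prohibition: its hypotheses
      can never all hold.\<close>
    assume notF: "\<not> family_F V E"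
    have "\<exists>y\<in>V. y \<noteq> r \<and> y \<noteq> b"
    proof (rule ccontr)
      assume "\<not> ?thesis"
      then have V: "V = {r, b}" "V - {r} = {b}" using bV rV by auto
      have "E = (\<lambda>v. {v, p v}) ` (V - {r})" using T by (simp add: rooted_def)
      then have "E = {{r, b}}" unfolding V(2) using bV by auto
      then show False using notF family_F.P2[of r b] V(1) bV(2) by auto
    qed
    then obtain z where z: "z \<in> V" "z \<noteq> r" "z \<noteq> b" by blast
    have child: "u \<in> V \<and> u \<noteq> r \<and> p u = v \<and> h u = Suc (h v)" if "u \<in> nbrs E v" "u \<noteq> p v" for u v
      using that h(2)[of u] by (auto simp: rooted_nbrs[OF T])
    have up: "p v \<in> V \<and> p v \<in> nbrs E v \<and> h v = Suc (h (p v))" if "v \<in> V" "v \<noteq> r" for v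
      using rooted_parent[OF T that] h(2)[of v] that by blast
    have no_deg2: "deg E u \<ge> 3" if "v \<in> V" "deg E v = 2" "u \<in> nbrs E v" for u v
    proof (rule ccontr)
      assume "\<not> ?thesis"
      then have "deg E u \<le> 2" by simp
      have "card (nbrs E v - {u}) = 1" using that finite_nbrs[OF sg, of v] by (simp add: deg_def)
      then obtain w where "nbrs E v - {u} = {w}" by (auto simp: card_1_singleton_iff)
      then have "nbrs E v = {u, w}" "u \<noteq> w" using that(3) by auto
      then show False
        using reduce_O1[OF T deg_r less.prems(3) that(1) _ _ \<open>deg E u \<le> 2\<close> IH] notF by blast
    qed
    have leaf_nb: "v \<in> nbrs E l" if "l \<in> nbrs E v" for l v using that nbrs_sym[of l E v] by simp
    \<comment> \<open>The leaf to be removed must not be the root; of two leaves, one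
      qualifies.\<close>
    have no_three: False if "l1 \<in> leaves V E" "l2 \<in> leaves V E" "l3 \<in> leaves V E"
      "l1 \<in> nbrs E v" "l2 \<in> nbrs E v" "l3 \<in> nbrs E v" "l1 \<noteq> l2" "l1 \<noteq> l3" "l2 \<noteq> l3" for v l1 l2 l3
    proof (cases "l1 = r")
      case False
      then show False
        using reduce_O2[OF T deg_r less.prems(3) that(1) leaf_nb[OF that(4)] False
            that(2) leaf_nb[OF that(5)] that(3) leaf_nb[OF that(6)] that(7-9) IH] notF by blast
    next
      case True
      then have "l2 \<noteq> r" using that(7) by auto
      then show False
        using reduce_O2[OF T deg_r less.prems(3) that(2) leaf_nb[OF that(5)] _
            that(1) leaf_nb[OF that(4)] that(3) leaf_nb[OF that(6)] that(7)[symmetric] that(9,8) IH]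
          notF by blast
    qed
    have no_children: "v \<in> leaves V E" if "v \<in> V" "v \<noteq> r" "\<And>u. u \<in> nbrs E v \<Longrightarrow> u = p v" for v
    proof -
      have "nbrs E v = {p v}" using that up[OF that(1,2)] by auto
      then show ?thesis using that(1) by (auto simp: leaves_iff)
    qed
    have leaf_deg: "deg E l = 1" if "l \<in> leaves V E" for l using that by (simp add: leaves_def)
    have ex_third: "\<exists>z\<in>nbrs E v. z \<noteq> a \<and> z \<noteq> b" if "deg E v \<ge> 3" for a b v
      using card_ge_3_other that by (simp add: deg_def)
    \<comment> \<open>Degree 2 is excluded by the leaf neighbor \<open>x\<close>, and a third leaf
      at \<open>c\<close> by \<open>no_three\<close>. The parent is not a leaf either, or it would
      be the third.\<close>
    have is_cherry: "\<exists>y. cherry V E c x y (p c)"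
      if c: "c \<in> V" "c \<noteq> r" and x: "x \<in> nbrs E c" "x \<noteq> p c"
        and lv: "\<And>u. u \<in> nbrs E c \<Longrightarrow> u \<noteq> p c \<Longrightarrow> u \<in> leaves V E" for c x
    proof -
      have pc: "p c \<in> nbrs E c" "p c \<in> V" using up[OF c] by auto
      have xl: "x \<in> leaves V E" using lv x by blast
      have "deg E c \<noteq> 2" using no_deg2[OF c(1) _ x(1)] leaf_deg[OF xl] by auto
      then have "deg E c \<ge> 3" using deg_ge_2I[OF sg x(1) pc(1) x(2)] by simp
      then obtain y where y: "y \<in> nbrs E c" "y \<noteq> x" "y \<noteq> p c" using ex_third by blast
      have yl: "y \<in> leaves V E" using lv y by blast
      have "w = x \<or> w = y \<or> w = p c" if "w \<in> nbrs E c" for w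
        using no_three[OF xl yl lv[OF that] x(1) y(1) that] y(2) by auto
      then have n: "nbrs E c = {x, y, p c}" using x y pc by auto
      have "p c \<notin> leaves V E" using no_three[OF xl yl _ x(1) y(1) pc(1)] x(2) y(2,3) by auto
      then have "cherry V E c x y (p c)"
        using n xl yl x(2) y(2,3) pc(2) by (auto simp: cherry_def inner_def)
      then show ?thesis by blast
    qed
    have "\<exists>x\<in>V. \<forall>y\<in>V. h y \<le> h x"
      using fin rV Max_in[of "h ` V"] Max_ge[of "h ` V"] by fastforce
    then obtain x where xV: "x \<in> V" and deepest: "\<And>y. y \<in> V \<Longrightarrow> h y \<le> h x" by blast
    have deep: "l \<in> leaves V E" if "l \<in> V" "h l = h x" for l
    proof (cases "l = r")
      case False
      then show ?thesis
        using no_children[OF that(1)] child[of _ l] deepest that(2) by fastforce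
    qed (use rl in simp)
    \<comment> \<open>The root has the only child \<open>b\<close>, so \<open>z\<close> lies at
      depth at least 2; hence deepest vertices have grandparents.\<close>
    have hx2: "h x \<ge> 2"
    proof (rule ccontr)
      assume "\<not> ?thesis"
      then have "h z \<le> 1" using deepest[OF z(1)] by simp
      then have "h (p z) = 0" using up[OF z(1,2)] by simp
      then have "p z = r" using up[of "p z"] up[OF z(1,2)] by fastforce
      then have "z \<in> nbrs E r" using z by (auto simp: rooted_nbrs[OF T])
      then show False using b z by auto
    qed
    have deep_cherry: "p l \<noteq> r \<and> l \<noteq> r \<and> (\<exists>y. cherry V E (p l) l y (p (p l)))"
      if l: "l \<in> V" "h l = h x" for l
    proof -
      have lr: "l \<noteq> r" using l hx2 h(1) by auto
      note u = up[OF l(1) lr]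
      have pr: "p l \<noteq> r" using u l hx2 h(1) by auto
      note uu = up[OF _ pr]
      have "l \<in> nbrs E (p l)" using u leaf_nb by blast
      moreover have "l \<noteq> p (p l)" using u uu by auto
      moreover have "w \<in> leaves V E" if "w \<in> nbrs E (p l)" "w \<noteq> p (p l)" for w
        using child[OF that] u l by (intro deep) auto
      ultimately show ?thesis using is_cherry[of "p l" l] u pr lr by blast
    qed
    have no_O4: False
      if "cherry V E c x y (p c)" "deg E (p c) \<ge> 3" "f c \<noteq> p c"
        "p c \<in> sources V E f \<Longrightarrow> \<exists>t\<in>sources V E f - {c, x, y}. t \<in> nbrs E (p c)" for c x y
      using reduce_O4[OF T deg_r f that(1) refl that(2-4) IH] notF by blast
    have inj: "c = c'" if "f c = f c'" "c \<in> inner V E" "c' \<in> inner V E" for c c'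
      using forcing_mapD(1)[OF f] that by (auto simp: inj_on_def)
    have forced: "f c \<notin> sources V E f" if "c \<in> inner V E" for c
      using that by (auto simp: sources_def)
    \<comment> \<open>Shown for every deepest vertex, since it is needed again in other subtrees
      below \<open>s\<close>.\<close>
    have grandparent: "deg E (p (p l)) = 2" if l: "l \<in> V" "h l = h x" for l
    proof (rule ccontr)
      assume ne2: "deg E (p (p l)) \<noteq> 2"
      define c q where "c = p l" and "q = p c"
      obtain y where ch: "cherry V E c l y q" using deep_cherry[OF l] by (auto simp: c_def q_def)
      note C = cherryD[OF sg ch]
      have lr: "l \<noteq> r" "c \<noteq> r" using deep_cherry[OF l] by (auto simp: c_def)
      have qr: "q \<noteq> r" using C(18) rl by (auto simp: inner_def)
      note uq = up[OF C(16) qr] and uc = up[OF C(15) lr(2)] and ul = up[OF l(1) lr(1)]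
      have hq: "h x = Suc (Suc (h q))" using uc ul l(2) by (simp add: c_def q_def)
      have "c \<noteq> p q" using uc uq by (auto simp: q_def)
      then have deg3: "deg E q \<ge> 3"
        using deg_ge_2I[OF sg C(4), of "p q"] uq ne2 by (auto simp: c_def q_def)
      have O4: False if "f c \<noteq> q" "q \<in> sources V E f \<Longrightarrow>
          \<exists>t\<in>sources V E f - {c, l, y}. t \<in> nbrs E q"
        using no_O4[of c l y] ch deg3 that by (simp add: q_def)
      have no_leaf: "w \<notin> leaves V E" if w: "w \<in> nbrs E q" for w
      proof
        assume wl: "w \<in> leaves V E"
        \<comment> \<open>Beside a leaf of \<open>q\<close>, O3 can be undone if \<open>c\<close>
          forces \<open>q\<close> or \<open>q\<close> is a source; in the remaining case O4
          can.\<close>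
        have "\<not> (f c = q \<or> q \<in> sources V E f)"
          using reduce_O3[OF T deg_r f ch _ wl leaf_nb[OF w] _ IH] notF by (auto simp: q_def)
        then show False using O4 by blast
      qed
      obtain c' where c': "c' \<in> nbrs E q" "c' \<noteq> c" "c' \<noteq> p q" using ex_third[OF deg3] by blast
      note cc = child[OF c'(1,3)]
      obtain x' where x': "x' \<in> nbrs E c'" "x' \<noteq> p c'"
        using no_leaf[OF c'(1)] no_children[of c'] cc by blast
      note cx = child[OF x']
      have hx': "h x' = h x" using cx cc hq by simp
      \<comment> \<open>So \<open>q\<close> has a second cherry below it. If \<open>c\<close> forces
        \<open>q\<close>, then \<open>c'\<close> does not and O4 is undone at \<open>c'\<close>;
        otherwise it is undone at \<open>c\<close>, with \<open>c'\<close> as the source that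
        remains for \<open>q\<close>.\<close>
      obtain y' where ch': "cherry V E c' x' y' q"
        using deep_cherry[of x'] hx' cx cc by auto
      have c'S: "c' \<in> sources V E f" by (rule cherry_source[OF sg ch' f])
      show False
      proof (cases "f c = q")
        case True
        then have "q \<notin> sources V E f" using forced[OF C(17)] by simp
        moreover have "f c' \<noteq> q" using inj[of c c'] True C(17) cherryD(17)[OF sg ch'] c'(2) by auto
        ultimately show False using no_O4[of c' x' y'] ch' deg3 cc by auto
      next
        case False
        have "c' \<notin> {c, l, y}" using c'(2) C(11,12) no_leaf[OF c'(1)] by auto
        then show False using O4[OF False] c'S c'(1) by blast
      qed
    qed
    define c q s where "c = p x" and "q = p c" and "s = p q"
    obtain y where ch: "cherry V E c x y q" using deep_cherry[OF xV] by (auto simp: c_def q_def)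
    note C = cherryD[OF sg ch]
    have cr: "x \<noteq> r" "c \<noteq> r" using deep_cherry[OF xV] by (auto simp: c_def)
    have qr: "q \<noteq> r" using C(18) rl by (auto simp: inner_def)
    note ux = up[OF xV cr(1), folded c_def] and uc = up[OF C(15) cr(2), folded q_def]
      and uq = up[OF C(16) qr, folded s_def]
    have deg_q: "deg E q = 2" using grandparent[OF xV] by (simp add: c_def q_def)
    have cs: "c \<noteq> s" using uc uq by auto
    have "{c, s} = nbrs E q"
    proof (rule card_subset_eq[OF finite_nbrs[OF sg]])
      show "{c, s} \<subseteq> nbrs E q" using C(4) uq by auto
      show "card {c, s} = card (nbrs E q)" using cs deg_q by (simp add: deg_def)
    qed
    then have nq: "nbrs E q = {c, s}" by simp
    have deg_s: "deg E s \<ge> 3" using no_deg2[OF C(16) deg_q] uq by blast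
    have sr: "s \<noteq> r" using deg_s deg_r by auto
    define t where "t = p s"
    note us = up[OF _ sr, folded t_def]
    have sV: "s \<in> V" using uq by simp
    have cS: "c \<in> sources V E f" by (rule cherry_source[OF sg ch f])
    have fq: "f q = s"
      using forcing_mapD(2)[OF f C(18)] nq forced[OF C(18)] cS by auto
    have sS: "s \<notin> sources V E f" using forced[OF C(18)] fq by simp
    have hs: "h x = Suc (Suc (Suc (h s)))" using ux uc uq by simp
    have qs: "q \<in> nbrs E s" using leaf_nb uq by blast
    have tq: "t \<noteq> q" using us[OF sV] uq by auto
    \<comment> \<open>A further child of \<open>s\<close> that is not a leaf would carry a cherry.
      It does not force \<open>s\<close>, which \<open>q\<close> forces, and \<open>s\<close> is no
      source, so O4 could be undone there.\<close>
    have side: "c' \<in> leaves V E" if c': "c' \<in> nbrs E s" "c' \<noteq> q" "c' \<noteq> t" for c'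
    proof (rule ccontr)
      assume nl: "c' \<notin> leaves V E"
      note cc = child[OF c'(1) c'(3)[unfolded t_def]]
      have c'i: "c' \<in> inner V E" using cc nl by (simp add: inner_def)
      have fc': "f c' \<noteq> s" using inj[of c' q] c'i C(18) c'(2) fq by auto
      obtain x' where x': "x' \<in> nbrs E c'" "x' \<noteq> p c'"
        using nl no_children[of c'] cc by blast
      have lv: "w \<in> leaves V E" if w: "w \<in> nbrs E c'" "w \<noteq> p c'" for w
      proof (rule ccontr)
        assume wl: "w \<notin> leaves V E"
        note cw = child[OF w]
        obtain w' where w': "w' \<in> nbrs E w" "w' \<noteq> p w"
          using wl no_children[of w] cw by blast
        note cw' = child[OF w']
        have hw': "h w' = h x" using cw' cw cc hs by simp
        have d2: "deg E c' = 2" using grandparent[OF _ hw'] cw' cw by simp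
        obtain y' where "cherry V E w w' y' c'" using deep_cherry[OF _ hw'] cw' cw by auto
        then have wS: "w \<in> sources V E f" by (rule cherry_source[OF sg _ f])
        have sn: "s \<in> nbrs E c'" using leaf_nb[OF c'(1)] .
        \<comment> \<open>If \<open>c'\<close> had a child \<open>w\<close> that is not a leaf, then
          \<open>c'\<close> would be the grandparent of a deepest vertex. Of its two neighbors,
          \<open>w\<close> is a source and \<open>s\<close> is taken by \<open>q\<close>, so
          \<open>c'\<close> could force neither.\<close>
        have "{w, s} = nbrs E c'"
        proof (rule card_subset_eq[OF finite_nbrs[OF sg]])
          show "{w, s} \<subseteq> nbrs E c'" using w(1) sn by auto
          show "card {w, s} = card (nbrs E c')" using w(2) cc d2 by (simp add: deg_def)
        qed
        then show False
          using forcing_mapD(2)[OF f c'i] fc' forced[OF c'i] wS by auto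
      qed
      obtain y' where "cherry V E c' x' y' s"
        using is_cherry[of c' x'] x' lv cc by auto
      then show False using no_O4[of c' x' y'] cc deg_s fc' sS by auto
    qed
    \<comment> \<open>A leaf at \<open>s\<close> that \<open>s\<close> does not force would make
      \<open>s\<close> a source. As \<open>s\<close> forces only one vertex, it has only one leaf
      neighbor.\<close>
    have side_forced: "f s = u \<and> s \<in> inner V E" if "u \<in> nbrs E s" "u \<in> leaves V E" for u
      using leaf_source(2)[OF f that(2) leaf_nb[OF that(1)]] sS by blast
    obtain u where u: "u \<in> nbrs E s" "u \<noteq> q" "u \<noteq> t" using ex_third[OF deg_s] by blast
    have ul: "u \<in> leaves V E" by (rule side[OF u])
    have fs: "f s = u" "s \<in> inner V E" using side_forced[OF u(1) ul] by auto
    have "z \<in> {q, u, t}" if "z \<in> nbrs E s" for z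
      using side[OF that] side_forced[OF that] fs(1) by blast
    then have ns: "nbrs E s = {q, u, t}" using qs u(1) us[OF sV] by blast
    have "t \<notin> leaves V E" using side_forced[of t] us[OF sV] fs(1) u(3) by auto
    then have ti: "t \<in> inner V E" using us[OF sV] by (simp add: inner_def)
    have tc: "t \<noteq> c" using us[OF sV] uq uc by auto
    have st: "s \<in> nbrs E t" using leaf_nb us[OF sV] by blast
    have ft: "f t \<noteq> s" using inj[of t q] ti C(18) tq fq by auto
    \<comment> \<open>Otherwise the neighbors of \<open>t\<close> are \<open>s\<close> and the
      vertex \<open>t'\<close> that \<open>t\<close> forces. Neither forces \<open>t\<close>, as
      \<open>s\<close> forces \<open>u\<close> and 2-cycles are excluded, so \<open>t\<close> is a
      source; but both neighbors are forced.\<close>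
    have "deg E t \<ge> 3"
    proof (rule ccontr)
      assume "\<not> ?thesis"
      define t' where "t' = f t"
      have t': "t' \<in> nbrs E t" "t' \<noteq> s" using forcing_mapD(2)[OF f ti] ft by (auto simp: t'_def)
      then have "card {s, t'} = 2" "card (nbrs E t) \<le> 2"
        using \<open>\<not> deg E t \<ge> 3\<close> by (auto simp: deg_def)
      then have "{s, t'} = nbrs E t"
        using st t'(1) by (intro card_seteq[OF finite_nbrs[OF sg]]) auto
      then have nt: "nbrs E t = {s, t'}" by simp
      have t'S: "t' \<notin> sources V E f" using forced[OF ti] by (simp add: t'_def)
      have "t \<in> sources V E f"
      proof (rule ccontr)
        assume "t \<notin> sources V E f"
        then obtain w where w: "w \<in> inner V E" "f w = t"
          using us[OF sV] by (auto simp: sources_def)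
        then have "w \<in> nbrs E t" using forcing_mapD(2)[OF f w(1)] leaf_nb by auto
        then have "w = t'" using nt w fs(1) u(3) by auto
        then show False using forcing_mapD(3)[OF f ti] w by (simp add: t'_def)
      qed
      then show False using forcing_mapD(4)[OF f] nt sS t'S by fastforce
    qed
    moreover have "distinct [q, u, t]" using u tq by auto
    ultimately have "family_F V E"
      using reduce_O5[OF T deg_r f ch nq cs ns ul _ q_def[symmetric] s_def[symmetric]
          t_def[symmetric] ti tc _ fs(1) fq IH] by blast
    then show False using notF by blast
  qed
qed

theorem theorem4:
  fixes V :: "'a set" and E :: "'a set set"
  assumes "tree V E"
    and "card V \<ge> 2"
  shows "total_forcing_number V E \<ge> card (leaves V E) \<and>
    (total_forcing_number V E = card (leaves V E) \<longleftrightarrow> family_F V E)"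
proof -
  have sg: "simple_graph V E" and con: "connected_graph V E" using assms(1) by (auto simp: tree_def)
  obtain v where "v \<in> V" using con by (auto simp: connected_graph_def)
  then obtain r where r: "r \<in> leaves V E" using tree_leaf[OF assms] by blast
  then have "r \<in> V" by (simp add: leaves_def)
  then obtain p d where T: "rooted V E r p d" using tree_rooted[OF assms(1)] by blast
  let ?P = "\<lambda>k. \<exists>S. total_forcing_set V E S \<and> card S = k"
  \<comment> \<open>The whole vertex set shows that the minimum in
    \<open>total_forcing_number\<close> is attained.\<close>
  have "total_forcing_set V E V"
    using connected_nbrs_nonempty[OF con assms(2)] nbrsD(1)[OF sg]
    unfolding total_forcing_set_iff[OF sg] by fast
  then have "\<exists>k. ?P k" by blast
  then have "?P (total_forcing_number V E)"
    using LeastI_ex[of ?P] by (simp only: total_forcing_number_def)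
  then obtain S where S: "total_forcing_set V E S" "card S = total_forcing_number V E" by blast
  have ge: "card (leaves V E) \<le> total_forcing_number V E"
    using total_forcing_set_ge(1)[OF sg S(1)] S(2) by simp
  moreover have "family_F V E" if "total_forcing_number V E = card (leaves V E)"
  proof (rule forcing_map_family_F[OF T])
    show "deg E r = 1" using r by (simp add: leaves_def)
    show "\<exists>f. forcing_map V E f" using total_forcing_set_ge(2)[OF sg S(1)] S(2) that by simp
  qed
  moreover have "total_forcing_number V E = card (leaves V E)" if F: "family_F V E"
  proof -
    obtain f where f: "forcing_map V E f" using family_F_forcing_map[OF F] by blast
    have "?P (card (leaves V E))"
      using forcing_map_forces[OF T f] card_sources[OF sg f] by blast
    then have "total_forcing_number V E \<le> card (leaves V E)"
      using Least_le[of ?P] by (simp only: total_forcing_number_def)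
    then show ?thesis using ge by simp
  qed
  ultimately show ?thesis by blast
qed

end
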